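(* A finite group presentation $\langle X\mid R\rangle$ is hyperbolic if and only if there exists a positive real constant $\alpha$ such that $\mathrm{Area}(c)\leqslant\alpha|c|$ for every proper corolla $c$.
   Context: $R$ is a set of non-empty cyclically reduced words with $R^{-1}\subset R$. A relator is a reduced word in the normal closure of $R$ in the free group $\mathcal F(X)$. $\mathrm{Area}(w)$ is the least $k$ such that the relator $w$ is the reduced form of a product of $k$ conjugates of elements of $R$. The Dehn function is $\Delta(n)=\max\{\mathrm{Area}(w):w\text{ a relator},|w|\leqslant n\}$; the presentation is hyperbolic if there is a positive real constant $\alpha$ with $\Delta(n)\leqslant\alpha n$ for all $n$. For a word $u$ there are unique reduced $t$ and cyclically reduced $w$ such that the reduced form of $u$ is the word $twt^{-1}$; $w$ is the cyclically reduced form of $u$; $\pi(u,v)$ is the cyclically reduced form of $uv$. $w_2w_1$ is a cyclic conjugate of $w_1w_2$; $w_1uw_2$ is an insertion of $u$ into $w_1w_2$. $C_1$ is the set of cyclic conjugates of elements of $R$; for $k>1$, $C_k$ is the set of cyclic conjugates of the words $\pi(u,v)$ where (1) $u\in C_{k-1},v\in C_1$ or $u\in C_1,v\in C_{k-1}$; (2) $u\ne v^{-1}$; (3) either $u^{-1}$ is a prefix of $v$, or $v^{-1}$ is a suffix of $u$, or the last letter of $u$ is the inverse of the first of $v$ but the first letter of $u$ is not the inverse of the last of $v$. $D_1$ is the set of reduced words of the form $uwu^{-1}$, $w\in C_1$ ($u$ possibly empty); for $k>1$, $D_k$ is the set of reduced words which are of the form $uwu^{-1}$ with $w\in C_k$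 ($u$ possibly empty) or are insertions of a word of $D_i$ into a word of $D_j$ with $i,j\geqslant1$, $i+j=k$. A proper corolla is a word $c$ such that, for some $k$, $c\in C_k$ and $c\notin D_h$ for all $h<k$. *)

theory Defs
  imports Complex_Main "HOL-Algebra.Coset" "HOL-Library.Sublist"
begin

text \<open>The letter \<open>(x, True)\<close> stands for the generator \<open>x\<close> and \<open>(x, False)\<close> for its
  inverse.\<close>

type_synonym 'a letter = "'a \<times> bool"
type_synonym 'a word = "'a letter list"

definition inv_letter :: "'a letter \<Rightarrow> 'a letter" where
  "inv_letter a = (fst a, \<not> snd a)"

definition inv_word :: "'a word \<Rightarrow> 'a word" where
  "inv_word w = rev (map inv_letter w)"

definition words_over :: "'a set \<Rightarrow> 'a word set" where
  "words_over X = lists (X \<times> UNIV)"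

definition reduced :: "'a word \<Rightarrow> bool" where
  "reduced w \<longleftrightarrow> successively (\<lambda>a b. b \<noteq> inv_letter a) w"

definition cyclically_reduced :: "'a word \<Rightarrow> bool" where
  "cyclically_reduced w \<longleftrightarrow>
     reduced w \<and> (w \<noteq> [] \<longrightarrow> last w \<noteq> inv_letter (hd w))"

definition red_cons :: "'a letter \<Rightarrow> 'a word \<Rightarrow> 'a word" where
  "red_cons a w = (if w \<noteq> [] \<and> hd w = inv_letter a then tl w else a # w)"

definition reduced_form :: "'a word \<Rightarrow> 'a word" where
  "reduced_form w = foldr red_cons w []"

definition cyclically_reduced_form :: "'a word \<Rightarrow> 'a word" where
  "cyclically_reduced_form u =
     (THE w. cyclically_reduced w \<and> (\<exists>t. reduced t \<and> reduced_form u = t @ w @ inv_word t))"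

definition free_group :: "'a set \<Rightarrow> 'a word monoid" where
  "free_group X = \<lparr>carrier = {w \<in> words_over X. reduced w},
                   mult = (\<lambda>u v. reduced_form (u @ v)),
                   one = []\<rparr>"

definition normal_closure :: "('b, 'm) monoid_scheme \<Rightarrow> 'b set \<Rightarrow> 'b set" where
  "normal_closure G S = \<Inter>{N. N \<lhd> G \<and> S \<subseteq> N}"

definition group_presentation :: "'a set \<Rightarrow> 'a word set \<Rightarrow> bool" where
  "group_presentation X R \<longleftrightarrow>
     R \<subseteq> words_over X \<and>
     (\<forall>r\<in>R. r \<noteq> [] \<and> cyclically_reduced r \<and> inv_word r \<in> R)"

definition relator :: "'a set \<Rightarrow> 'a word set \<Rightarrow> 'a word \<Rightarrow> bool" where
  "relator X R w \<longleftrightarrow> w \<in> normal_closure (free_group X) R"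

text \<open>In \<open>area\<close>, the list \<open>ps\<close> holds the pairs \<open>(t, r)\<close> of a conjugating word and an element
  of \<open>R\<close>. The value is meaningful for relators only.\<close>

definition area :: "'a set \<Rightarrow> 'a word set \<Rightarrow> 'a word \<Rightarrow> nat" where
  "area X R w =
     (LEAST k. \<exists>ps. length ps = k \<and> set ps \<subseteq> words_over X \<times> R \<and>
        w = reduced_form (concat (map (\<lambda>(t, r). t @ r @ inv_word t) ps)))"

text \<open>The maximum is over a finite set when \<open>X\<close> is finite.\<close>

definition dehn :: "'a set \<Rightarrow> 'a word set \<Rightarrow> nat \<Rightarrow> nat" where
  "dehn X R n = Max {area X R w | w. relator X R w \<and> length w \<le> n}"

definition hyperbolic_presentation :: "'a set \<Rightarrow> 'a word set \<Rightarrow> bool" where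
  "hyperbolic_presentation X R \<longleftrightarrow>
     (\<exists>\<alpha>::real. \<alpha> > 0 \<and> (\<forall>n. real (dehn X R n) \<le> \<alpha> * real n))"

definition cyclic_conjugate :: "'a word \<Rightarrow> 'a word \<Rightarrow> bool" where
  "cyclic_conjugate w' w \<longleftrightarrow> (\<exists>w1 w2. w = w1 @ w2 \<and> w' = w2 @ w1)"

definition pi_word :: "'a word \<Rightarrow> 'a word \<Rightarrow> 'a word" where
  "pi_word u v = cyclically_reduced_form (u @ v)"

definition C_cond :: "'a word \<Rightarrow> 'a word \<Rightarrow> bool" where
  "C_cond u v \<longleftrightarrow>
     u \<noteq> inv_word v \<and>
     (prefix (inv_word u) v \<or> suffix (inv_word v) u \<or>
      last u = inv_letter (hd v) \<and> hd u \<noteq> inv_letter (last v))"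

text \<open>The sets \<open>C\<^sub>k\<close> and \<open>D\<^sub>k\<close> are indexed from 1; the index 0 gives the empty set.\<close>

fun C_set :: "'a word set \<Rightarrow> nat \<Rightarrow> 'a word set" where
  "C_set R 0 = {}"
| "C_set R (Suc 0) = {c. \<exists>r\<in>R. cyclic_conjugate c r}"
| "C_set R (Suc (Suc k)) =
     {c. \<exists>u v. (u \<in> C_set R (Suc k) \<and> v \<in> C_set R (Suc 0) \<or>
                u \<in> C_set R (Suc 0) \<and> v \<in> C_set R (Suc k)) \<and>
               C_cond u v \<and> cyclic_conjugate c (pi_word u v)}"

inductive_set D_rel :: "'a set \<Rightarrow> 'a word set \<Rightarrow> (nat \<times> 'a word) set"
  for X :: "'a set" and R :: "'a word set"
where
  conj: "k \<ge> 1 \<Longrightarrow> w \<in> C_set R k \<Longrightarrow> u \<in> words_over X \<Longrightarrow>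
     reduced (u @ w @ inv_word u) \<Longrightarrow> (k, u @ w @ inv_word u) \<in> D_rel X R"
| insertion: "i \<ge> 1 \<Longrightarrow> j \<ge> 1 \<Longrightarrow> (i, u) \<in> D_rel X R \<Longrightarrow> (j, w1 @ w2) \<in> D_rel X R \<Longrightarrow>
     reduced (w1 @ u @ w2) \<Longrightarrow> (i + j, w1 @ u @ w2) \<in> D_rel X R"

definition D_set :: "'a set \<Rightarrow> 'a word set \<Rightarrow> nat \<Rightarrow> 'a word set" where
  "D_set X R k = {w. (k, w) \<in> D_rel X R}"

definition proper_corolla :: "'a set \<Rightarrow> 'a word set \<Rightarrow> 'a word \<Rightarrow> bool" where
  "proper_corolla X R c \<longleftrightarrow> (\<exists>k. c \<in> C_set R k \<and> (\<forall>h<k. c \<notin> D_set X R h))"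


lemma inv_letter_inv_letter [simp]: "inv_letter (inv_letter a) = a"
  by (simp add: inv_letter_def)

lemma inv_letter_neq [simp]: "inv_letter a \<noteq> a" "a \<noteq> inv_letter a"
  by (auto simp: inv_letter_def prod_eq_iff)

lemma inv_letter_eq_iff [simp]: "inv_letter a = inv_letter b \<longleftrightarrow> a = b"
  by (metis inv_letter_inv_letter)

lemma reduced_Nil [simp]: "reduced []"
  by (simp add: reduced_def)

lemma reduced_Cons: "reduced (a # w) \<longleftrightarrow> (w = [] \<or> hd w \<noteq> inv_letter a) \<and> reduced w"
  by (auto simp: reduced_def successively_Cons)

lemma reduced_red_cons: "reduced w \<Longrightarrow> reduced (red_cons a w)"
  by (cases w) (auto simp: red_cons_def reduced_Cons)

lemma red_cons_cancel: "reduced w \<Longrightarrow> red_cons a (red_cons (inv_letter a) w) = w"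
  by (cases w; cases "tl w") (auto simp: red_cons_def reduced_Cons)

lemma reduced_foldr: "reduced v \<Longrightarrow> reduced (foldr red_cons u v)"
  by (induction u) (auto simp: reduced_red_cons)

lemma reduced_reduced_form [simp]: "reduced (reduced_form w)"
  by (simp add: reduced_form_def reduced_foldr)

lemma reduced_form_id: "reduced w \<Longrightarrow> reduced_form w = w"
  by (induction w) (auto simp: reduced_form_def reduced_Cons red_cons_def)

lemma reduced_form_append: "reduced_form (u @ v) = foldr red_cons u (reduced_form v)"
  by (simp add: reduced_form_def)

lemma foldr_red_cons: "reduced v \<Longrightarrow> foldr red_cons (red_cons a u) v = red_cons a (foldr red_cons u v)"
proof (cases "u \<noteq> [] \<and> hd u = inv_letter a")
  case True
  then obtain u' where "u = inv_letter a # u'" by (cases u) auto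
  moreover assume "reduced v"
  ultimately show ?thesis by (simp add: red_cons_def[of a "inv_letter a # u'"] red_cons_cancel reduced_foldr)
qed (auto simp: red_cons_def[of a u])

lemma foldr_reduced_form: "reduced v \<Longrightarrow> foldr red_cons (reduced_form u) v = foldr red_cons u v"
  by (induction u) (auto simp: reduced_form_def foldr_red_cons)

lemma reduced_form_left [simp]: "reduced_form (reduced_form u @ v) = reduced_form (u @ v)"
  by (simp add: reduced_form_append foldr_reduced_form)

lemma reduced_form_right [simp]: "reduced_form (u @ reduced_form v) = reduced_form (u @ v)"
  by (simp add: reduced_form_append reduced_form_id)

lemma reduced_form_delete: "reduced_form (u @ a # inv_letter a # v) = reduced_form (u @ v)"
proof -
  have "red_cons a (red_cons (inv_letter a) (reduced_form v)) = reduced_form v"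
    by (rule red_cons_cancel) simp
  then show ?thesis
    by (simp add: reduced_form_def)
qed

lemma words_over_simps [simp]:
  "[] \<in> words_over X" "a # w \<in> words_over X \<longleftrightarrow> fst a \<in> X \<and> w \<in> words_over X"
  "u @ v \<in> words_over X \<longleftrightarrow> u \<in> words_over X \<and> v \<in> words_over X"
  by (auto simp: words_over_def mem_Times_iff)

lemma inv_word_simps [simp]:
  "inv_word [] = []" "inv_word (a # w) = inv_word w @ [inv_letter a]"
  "inv_word (u @ v) = inv_word v @ inv_word u" "inv_word (inv_word w) = w"
  by (auto simp: inv_word_def rev_map comp_def)

lemma inv_word_over [simp]: "inv_word w \<in> words_over X \<longleftrightarrow> w \<in> words_over X"
  by (induction w) (auto simp: inv_letter_def)

lemma reduced_form_over: "w \<in> words_over X \<Longrightarrow> reduced_form w \<in> words_over X"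
proof (induction w)
  case (Cons a w)
  then show ?case
    by (cases "reduced_form w") (auto simp: reduced_form_def red_cons_def)
qed (simp add: reduced_form_def)

lemma reduced_form_inverse: "reduced_form (inv_word w @ w) = []"
proof (induction w)
  case (Cons a w)
  then show ?case
    using reduced_form_delete[of "inv_word w" "inv_letter a" w] by simp
qed (simp add: reduced_form_def)

lemma group_free_group: "group (free_group X)"
proof (rule groupI)
  fix u assume u: "u \<in> carrier (free_group X)"
  have "reduced_form (inv_word u) \<in> carrier (free_group X)"
    using u by (simp add: free_group_def reduced_form_over)
  moreover have "reduced_form (inv_word u) \<otimes>\<^bsub>free_group X\<^esub> u = \<one>\<^bsub>free_group X\<^esub>"
    by (simp add: free_group_def reduced_form_inverse)
  ultimately show "\<exists>v\<in>carrier (free_group X). v \<otimes>\<^bsub>free_group X\<^esub> u = \<one>\<^bsub>free_group X\<^esub>"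
    by blast
qed (auto simp: free_group_def reduced_form_over reduced_form_id)

lemma reduced_append_conj:
  assumes "reduced w"
  shows "\<exists>t w'. reduced t \<and> cyclically_reduced w' \<and> w = t @ w' @ inv_word t"
  using assms
proof (induction "length w" arbitrary: w rule: less_induct)
  case less
  show ?case
  proof (cases "cyclically_reduced w")
    case True
    then show ?thesis by (intro exI[of _ "[]"] exI[of _ w]) simp
  next
    case False
    then have ne: "w \<noteq> []" and l: "last w = inv_letter (hd w)"
      using less.prems by (auto simp: cyclically_reduced_def)
    then obtain a v where w: "w = a # v" by (cases w) auto
    with l have "v \<noteq> []" by auto
    with l w obtain x where v: "v = x @ [inv_letter a]"
      by (metis append_butlast_last_id last_ConsR list.sel(1))
    have "reduced x" using less.prems w v
      by (auto simp: reduced_def successively_Cons successively_append_iff)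
    with less.hyps[of x] w v obtain t w' where t: "reduced t" "cyclically_reduced w'"
      "x = t @ w' @ inv_word t" by auto
    have "reduced (a # t)"
      using less.prems t(1) unfolding w v t(3) by (cases t) (auto simp: reduced_Cons)
    then show ?thesis using t(2)
      by (intro exI[of _ "a # t"] exI[of _ w']) (simp add: w v t(3))
  qed
qed

lemma conj_form_unique:
  assumes "t @ w @ inv_word t = t' @ w' @ inv_word t'"
    "cyclically_reduced w" "cyclically_reduced w'"
  shows "t = t' \<and> w = w'"
  using assms
proof (induction t arbitrary: t')
  case Nil
  show ?case
  proof (cases t')
    case (Cons a s)
    with Nil have "w = a # (s @ w' @ inv_word s) @ [inv_letter a]" by simp
    with Nil.prems(2) show ?thesis by (simp add: cyclically_reduced_def)
  qed (use Nil in simp)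
next
  case (Cons a s)
  show ?case
  proof (cases t')
    case Nil
    with Cons.prems have "w' = a # (s @ w @ inv_word s) @ [inv_letter a]" by simp
    with Cons.prems(3) show ?thesis by (simp add: cyclically_reduced_def)
  next
    case (Cons b s')
    have "a = b" "s @ w @ inv_word s = s' @ w' @ inv_word s'"
      using Cons.prems(1) \<open>t' = b # s'\<close> by auto
    then show ?thesis using Cons.IH[of s'] Cons.prems(2,3) \<open>t' = b # s'\<close> by auto
  qed
qed

lemma cyclically_reduced_form_unique:
  "\<exists>!(t, w). reduced t \<and> cyclically_reduced w \<and> reduced_form u = t @ w @ inv_word t"
proof -
  obtain t w where "reduced t" "cyclically_reduced w" "reduced_form u = t @ w @ inv_word t"
    using reduced_append_conj[of "reduced_form u"] by auto
  moreover have "t' = t \<and> w' = w"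
    if "cyclically_reduced w'" "reduced_form u = t' @ w' @ inv_word t'" for t' w'
    using conj_form_unique[of t' w' t w] that calculation by metis
  ultimately show ?thesis
    by (intro ex1I[of _ "(t, w)"]) fast+
qed

end

theory Submission
  imports Defs
begin

text \<open>
  A relator is the boundary word of a planar tree-like arrangement (a cactus) of edges and corollas:
  initially of lollipops, one for each factor \<open>t r t\<^sup>-\<^sup>1\<close>. Reduce its boundary word by folding pairs of
  adjacent edges. The only fold which does not immediately yield another cactus is that of two corollas
  of \<open>k \<ge> l\<close> faces along an edge, as corollas grow by one face at a time; there one moves the face of
  the smaller corolla which contains that edge to the larger one and scatters the other \<open>l - 1\<close> faces.
  This ends since it increases the sum of \<open>3 ^ k\<close> over the corollas while the number of faces is fixed.

  Hence a non-empty relator bounds a cactus and contains a corolla \<open>c\<close> as a subword, namely an outermost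
  one. Removing the longest subword \<open>u c u\<^sup>-\<^sup>1\<close> shows inductively that every non-empty relator is in
  some \<open>D\<^sub>k\<close>. A linear area bound passes from proper corollas to all of \<open>D\<^sub>k\<close> by induction on \<open>k\<close>: area
  is subadditive under insertions, and a corolla in \<open>C\<^sub>k\<close> which is not proper at \<open>k\<close> is in \<open>D\<^sub>h\<close> with
  \<open>h < k\<close>.
\<close>

section \<open>Words and the free group\<close>

lemma words_over_UNIV [simp]: "words_over UNIV = UNIV"
  by (auto simp: words_over_def)

lemma letter_in_append:
  assumes "p @ q = a @ x # b"
  obtains (left) e where "p = a @ x # e" "b = e @ q"
  | (right) e where "q = e @ x # b" "a = p @ e"
  using assms by (auto simp: append_eq_append_conv2 append_eq_Cons_conv Cons_eq_append_conv)

lemma reduced_append: "reduced (u @ v) \<longleftrightarrow>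
    reduced u \<and> reduced v \<and> (u \<noteq> [] \<longrightarrow> v \<noteq> [] \<longrightarrow> hd v \<noteq> inv_letter (last u))"
  by (auto simp: reduced_def successively_append_iff)

text \<open>Folding \<open>red_cons\<close> over a word is its left action on reduced words, so the
  action of the inverse word undoes it.\<close>

lemma foldr_inv_word_cancel: "reduced s \<Longrightarrow> foldr red_cons (inv_word w) (foldr red_cons w s) = s"
proof (induction w arbitrary: s)
  case (Cons a w)
  then show ?case
    using red_cons_cancel[of "foldr red_cons w s" "inv_letter a"] by (simp add: reduced_foldr)
qed simp

lemma foldr_word_cancel: "reduced s \<Longrightarrow> foldr red_cons w (foldr red_cons (inv_word w) s) = s"
  using foldr_inv_word_cancel[of s "inv_word w"] by simp

lemma reduced_form_Nil [simp]: "reduced_form [] = []"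
  by (simp add: reduced_form_def)

lemma reduced_form_inv_cancel [simp]: "reduced_form (w @ inv_word w) = []"
  using reduced_form_inverse[of "inv_word w"] by simp

lemma foldr_reduced_form_inv_word [simp]:
  "foldr red_cons w (reduced_form (inv_word w)) = []"
  "foldr red_cons (inv_word w) (reduced_form w) = []"
  by (metis reduced_form_append reduced_form_inv_cancel, metis reduced_form_append reduced_form_inverse)

text \<open>These turn a reduced form into an iterated action on reduced words, where neighbouring
  inverse blocks cancel; most identities in the free group are settled this way.\<close>

lemmas free_simps = reduced_form_append reduced_foldr foldr_inv_word_cancel foldr_word_cancel

lemma reduced_form_cong:
  assumes "reduced_form u = reduced_form v"
  shows "reduced_form (a @ u @ b) = reduced_form (a @ v @ b)"
proof -
  have "reduced_form (u @ b) = reduced_form (v @ b)"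
    using assms by (metis reduced_form_left)
  then show ?thesis by (metis reduced_form_right)
qed

lemma reduced_form_eq_Nil_iff: "reduced_form (u @ v) = [] \<longleftrightarrow> reduced_form u = reduced_form (inv_word v)"
proof
  assume "reduced_form (u @ v) = []"
  then have "reduced_form ((u @ v) @ inv_word v) = reduced_form (inv_word v)"
    by (metis append_Nil reduced_form_left)
  moreover have "reduced_form ((u @ v) @ inv_word v) = reduced_form u"
    using reduced_form_cong[of "v @ inv_word v" "[]" u "[]"] by simp
  ultimately show "reduced_form u = reduced_form (inv_word v)" by simp
next
  assume "reduced_form u = reduced_form (inv_word v)"
  then show "reduced_form (u @ v) = []"
    by (metis reduced_form_inverse reduced_form_left)
qed

lemma reduced_form_inv_word_cong:
  assumes "reduced_form u = reduced_form v"
  shows "reduced_form (inv_word u) = reduced_form (inv_word v)"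
proof -
  have "reduced_form (u @ inv_word v) = []"
    using assms reduced_form_eq_Nil_iff[of u "inv_word v"] by simp
  then have "reduced_form (inv_word u @ u @ inv_word v) = reduced_form (inv_word u)"
    by (metis append_Nil2 reduced_form_right)
  then show ?thesis by (simp add: free_simps)
qed

lemma not_reducedE:
  assumes "\<not> reduced w"
  obtains a x b where "w = a @ [x, inv_letter x] @ b"
proof -
  have "\<exists>a x b. w = a @ [x, inv_letter x] @ b"
    using assms
  proof (induction w)
    case (Cons y w)
    show ?case
    proof (cases "reduced w")
      case True
      with Cons.prems obtain w' where "w = inv_letter y # w'"
        by (cases w) (auto simp: reduced_Cons)
      then show ?thesis by (intro exI[of _ "[]"] exI[of _ y] exI[of _ w']) simp
    next
      case False
      with Cons.IH obtain a x b where "w = a @ [x, inv_letter x] @ b" by blast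
      then show ?thesis by (intro exI[of _ "y # a"] exI[of _ x] exI[of _ b]) simp
    qed
  qed simp
  with that show thesis by blast
qed

lemma reduced_no_cancelling_pair: "\<not> reduced (a @ x # inv_letter x # b)"
  by (simp add: reduced_append reduced_Cons)

text \<open>A surviving letter can be traced to an occurrence across which nothing cancels. This
  carries statements about boundary letters over to reduced forms.\<close>

lemma letter_of_reduced_form:
  assumes "reduced_form w = a @ x # b"
  shows "\<exists>w1 w2. w = w1 @ x # w2 \<and> reduced_form w1 = a \<and> reduced_form w2 = b"
  using assms
proof (induction w arbitrary: a)
  case (Cons y w)
  have rc: "reduced_form (y # w) = red_cons y (reduced_form w)" for w
    by (simp add: reduced_form_def)
  show ?case
  proof (cases "reduced_form w \<noteq> [] \<and> hd (reduced_form w) = inv_letter y")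
    case True
    with Cons.prems have "reduced_form w = (inv_letter y # a) @ x # b"
      unfolding rc by (cases "reduced_form w") (auto simp: red_cons_def)
    then obtain w1 w2 where "w = w1 @ x # w2" "reduced_form w1 = inv_letter y # a"
      "reduced_form w2 = b" using Cons.IH by blast
    then show ?thesis
      by (intro exI[of _ "y # w1"] exI[of _ w2]) (simp add: rc red_cons_def)
  next
    case False
    with Cons.prems have eq: "y # reduced_form w = a @ x # b"
      unfolding rc by (auto simp: red_cons_def)
    show ?thesis
    proof (cases a)
      case Nil
      with eq show ?thesis by (intro exI[of _ "[]"] exI[of _ w]) simp
    next
      case (Cons z a')
      with eq have "reduced_form w = a' @ x # b" "z = y" by auto
      then obtain w1 w2 where w: "w = w1 @ x # w2" "reduced_form w1 = a'" "reduced_form w2 = b"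
        using Cons.IH by blast
      have "reduced (y # a')"
        using eq reduced_reduced_form[of "y # w"] Cons.prems \<open>z = y\<close> Cons
        by (metis append_Cons reduced_append)
      then have "red_cons y a' = y # a'"
        by (auto simp: reduced_Cons red_cons_def)
      with w show ?thesis
        using \<open>z = y\<close> Cons by (intro exI[of _ "y # w1"] exI[of _ w2]) (simp add: rc)
    qed
  qed
qed simp

text \<open>Induction from the end of \<open>p\<close>: while its last letter cancels against the
  first one of \<open>q\<close>, both are moved into \<open>u\<close>.\<close>

lemma cancel_junction:
  assumes "reduced p" "reduced q"
  shows "\<exists>p' u q'. p = p' @ u \<and> q = inv_word u @ q' \<and> reduced (p' @ q')"
  using assms
proof (induction p arbitrary: q rule: rev_induct)
  case Nil
  then show ?case by (intro exI[of _ "[]"] exI[of _ q]) simp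
next
  case (snoc x p)
  show ?case
  proof (cases "q \<noteq> [] \<and> hd q = inv_letter x")
    case True
    then obtain q0 where q: "q = inv_letter x # q0" by (cases q) auto
    with snoc obtain p' u q' where "p = p' @ u" "q0 = inv_word u @ q'" "reduced (p' @ q')"
      by (metis reduced_Cons reduced_append)
    then show ?thesis
      by (intro exI[of _ p'] exI[of _ "u @ [x]"] exI[of _ q']) (simp add: q)
  next
    case False
    then have "reduced ((p @ [x]) @ q)"
      using snoc.prems by (subst reduced_append) auto
    then show ?thesis
      by (intro exI[of _ "p @ [x]"] exI[of _ "[]"] exI[of _ q]) simp
  qed
qed

lemma inv_word_eq_Nil_iff [simp]: "inv_word w = [] \<longleftrightarrow> w = []"
  by (simp add: inv_word_def)

lemma last_inv_word: "w \<noteq> [] \<Longrightarrow> last (inv_word w) = inv_letter (hd w)"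
  by (cases w) auto

lemma hd_inv_word: "w \<noteq> [] \<Longrightarrow> hd (inv_word w) = inv_letter (last w)"
  using last_inv_word[of "inv_word w"] by (metis inv_letter_inv_letter inv_word_eq_Nil_iff inv_word_simps(4))

lemma reduced_inv_word: "reduced w \<Longrightarrow> reduced (inv_word w)"
  by (induction w) (auto simp: reduced_append reduced_Cons last_inv_word)

lemma cyclic_conjugate_refl [simp]: "cyclic_conjugate w w"
  by (auto simp: cyclic_conjugate_def)

lemma cyclic_conjugate_append [simp]: "cyclic_conjugate (b @ a) (a @ b)"
  by (auto simp: cyclic_conjugate_def)

lemma cyclic_conjugate_iff_rotate: "cyclic_conjugate w' w \<longleftrightarrow> (\<exists>n. w' = rotate n w)"
  by (metis append_take_drop_id cyclic_conjugate_def rotate_append rotate_drop_take)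

lemma cyclic_conjugate_trans:
  "cyclic_conjugate u v \<Longrightarrow> cyclic_conjugate v w \<Longrightarrow> cyclic_conjugate u w"
  by (auto simp: cyclic_conjugate_iff_rotate rotate_rotate)

lemma cyclically_reduced_cyclic_conjugate:
  assumes "cyclic_conjugate w' w" "cyclically_reduced w"
  shows "cyclically_reduced w'"
proof -
  obtain a b where w: "w = a @ b" "w' = b @ a"
    using assms(1) by (auto simp: cyclic_conjugate_def)
  show ?thesis
  proof (cases "a = [] \<or> b = []")
    case False
    then have "last b \<noteq> inv_letter (hd a)" "hd b \<noteq> inv_letter (last a)" "reduced a" "reduced b"
      using assms(2) by (auto simp: w cyclically_reduced_def reduced_append)
    then have "hd a \<noteq> inv_letter (last b)" "last a \<noteq> inv_letter (hd b)"
      by (metis inv_letter_inv_letter)+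
    with \<open>reduced a\<close> \<open>reduced b\<close> False show ?thesis
      by (auto simp: w cyclically_reduced_def reduced_append)
  qed (use assms(2) w in auto)
qed

lemma pi_word_conj:
  obtains t where "cyclically_reduced (pi_word u v)" "reduced_form (u @ v) = t @ pi_word u v @ inv_word t"
proof -
  let ?P = "\<lambda>w. cyclically_reduced w \<and> (\<exists>t. reduced t \<and> reduced_form (u @ v) = t @ w @ inv_word t)"
  obtain t w where tw: "reduced t" "cyclically_reduced w" "reduced_form (u @ v) = t @ w @ inv_word t"
    using reduced_append_conj[of "reduced_form (u @ v)"] by auto
  have "?P (THE w. ?P w)"
  proof (rule theI[of ?P w])
    show "?P w" using tw by blast
    show "w' = w" if "?P w'" for w'
      using that tw conj_form_unique by metis
  qed
  with that show thesis
    unfolding pi_word_def cyclically_reduced_form_def by blast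
qed

section \<open>Products of conjugates of relators\<close>

text \<open>The products from \<open>area\<close>, but compared up to reduction, so that unreduced
  words can be handled; there are exactly \<open>k\<close> factors.\<close>

definition conj_prod :: "'a set \<Rightarrow> 'a word set \<Rightarrow> nat \<Rightarrow> 'a word \<Rightarrow> bool" where
  "conj_prod X R k w \<longleftrightarrow> (\<exists>ps. length ps = k \<and> set ps \<subseteq> words_over X \<times> R \<and>
     reduced_form w = reduced_form (concat (map (\<lambda>(t, r). t @ r @ inv_word t) ps)))"

lemma area_eq_conj_prod: "reduced w \<Longrightarrow> area X R w = (LEAST k. conj_prod X R k w)"
  by (simp add: area_def conj_prod_def reduced_form_id)

lemma area_le: "reduced w \<Longrightarrow> conj_prod X R k w \<Longrightarrow> area X R w \<le> k"
  by (simp add: area_eq_conj_prod Least_le)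

lemma conj_prod_area: "reduced w \<Longrightarrow> conj_prod X R k w \<Longrightarrow> conj_prod X R (area X R w) w"
  using LeastI[of "\<lambda>k. conj_prod X R k w" k] by (simp add: area_eq_conj_prod)

lemma conj_prod_cong: "conj_prod X R k u \<Longrightarrow> reduced_form u = reduced_form v \<Longrightarrow> conj_prod X R k v"
  by (simp add: conj_prod_def)

lemma conj_prod_reduced_form [simp]: "conj_prod X R k (reduced_form w) \<longleftrightarrow> conj_prod X R k w"
  by (simp add: conj_prod_def reduced_form_id)

lemma conj_prod_0: "reduced_form w = [] \<Longrightarrow> conj_prod X R 0 w"
  by (simp add: conj_prod_def)

lemma conj_prod_mult:
  assumes "conj_prod X R k u" "conj_prod X R l v"
  shows "conj_prod X R (k + l) (u @ v)"
proof -
  let ?f = "\<lambda>ps. concat (map (\<lambda>(t, r). t @ r @ inv_word t) ps)"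
  obtain ps qs where ps: "length ps = k" "set ps \<subseteq> words_over X \<times> R" "reduced_form u = reduced_form (?f ps)"
    and qs: "length qs = l" "set qs \<subseteq> words_over X \<times> R" "reduced_form v = reduced_form (?f qs)"
    using assms by (auto simp: conj_prod_def)
  have "reduced_form (u @ v) = reduced_form (?f ps @ ?f qs)"
    using reduced_form_cong[OF ps(3), of "[]" v] reduced_form_cong[OF qs(3), of "?f ps" "[]"] by simp
  then show ?thesis
    unfolding conj_prod_def using ps(1,2) qs(1,2) by (intro exI[of _ "ps @ qs"]) simp
qed

lemma conj_prod_relator: "r \<in> R \<Longrightarrow> t \<in> words_over X \<Longrightarrow> conj_prod X R 1 (t @ r @ inv_word t)"
  unfolding conj_prod_def by (intro exI[of _ "[(t, r)]"]) auto

lemma conj_prod_induct [consumes 1, case_names Nil Cons]: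
  assumes "conj_prod X R k w"
    and "\<And>w. reduced_form w = [] \<Longrightarrow> P 0 w"
    and "\<And>t r k u w. t \<in> words_over X \<Longrightarrow> r \<in> R \<Longrightarrow> conj_prod X R k u \<Longrightarrow> P k u \<Longrightarrow>
      reduced_form w = reduced_form (t @ r @ inv_word t @ u) \<Longrightarrow> P (Suc k) w"
  shows "P k w"
proof -
  let ?f = "\<lambda>ps. concat (map (\<lambda>(t, r). t @ r @ inv_word t) ps)"
  have "P (length ps) w" if "set ps \<subseteq> words_over X \<times> R" "reduced_form w = reduced_form (?f ps)" for ps w
    using that
  proof (induction ps arbitrary: w)
    case Nil
    then show ?case using assms(2) by simp
  next
    case (Cons p ps)
    obtain t r where p: "p = (t, r)" by force
    have "conj_prod X R (length ps) (?f ps)"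
      using Cons.prems unfolding conj_prod_def by auto
    moreover have "P (length ps) (?f ps)" using Cons by auto
    ultimately show ?case using assms(3)[of t r "length ps" "?f ps" w] Cons.prems p by simp
  qed
  with assms(1) show ?thesis by (auto simp: conj_prod_def)
qed

lemma conj_prod_conj:
  assumes "conj_prod X R k w" "s \<in> words_over X"
  shows "conj_prod X R k (s @ w @ inv_word s)"
  using assms(1)
proof (induction rule: conj_prod_induct)
  case (Nil w)
  then have "reduced_form (s @ w @ inv_word s) = []"
    using reduced_form_cong[of w "[]" s "inv_word s"] by simp
  then show ?case by (rule conj_prod_0)
next
  case (Cons t r k u w)
  have "conj_prod X R (1 + k) (((s @ t) @ r @ inv_word (s @ t)) @ (s @ u @ inv_word s))"
    using Cons assms(2) by (intro conj_prod_mult conj_prod_relator) auto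
  moreover have "reduced_form (((s @ t) @ r @ inv_word (s @ t)) @ (s @ u @ inv_word s))
     = reduced_form (s @ w @ inv_word s)"
    using reduced_form_cong[OF Cons.hyps(4), of s "inv_word s"] by (simp add: free_simps)
  ultimately show ?case by (metis conj_prod_cong plus_1_eq_Suc)
qed

text \<open>Inversion reverses the order of the factors and inverts each relator in place.\<close>

lemma conj_prod_inv:
  assumes "conj_prod X R k w" "\<And>r. r \<in> R \<Longrightarrow> inv_word r \<in> R"
  shows "conj_prod X R k (inv_word w)"
  using assms(1)
proof (induction rule: conj_prod_induct)
  case (Nil w)
  then show ?case using reduced_form_inv_word_cong[of w "[]"] by (intro conj_prod_0) simp
next
  case (Cons t r k u w)
  have "conj_prod X R (k + 1) (inv_word u @ (t @ inv_word r @ inv_word t))"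
    using Cons assms(2) by (intro conj_prod_mult conj_prod_relator) auto
  moreover have "reduced_form (inv_word u @ (t @ inv_word r @ inv_word t)) = reduced_form (inv_word w)"
    using reduced_form_inv_word_cong[OF Cons.hyps(4)] by simp
  ultimately show ?case by (metis conj_prod_cong Suc_eq_plus1)
qed

section \<open>The normal closure as the set of products of conjugates\<close>

lemma inv_free_group:
  assumes "w \<in> carrier (free_group X)"
  shows "inv\<^bsub>free_group X\<^esub> w = inv_word w"
  using assms
  by (intro group.inv_equality[OF group_free_group])
     (auto simp: free_group_def reduced_form_inverse reduced_inv_word)

text \<open>Products of conjugates form a normal subgroup containing \<open>R\<close>; by induction
  on the number of factors they lie in every such subgroup.\<close>

lemma relator_iff:
  assumes "group_presentation X R"
  shows "relator X R w \<longleftrightarrow> w \<in> words_over X \<and> reduced w \<and> (\<exists>k. conj_prod X R k w)"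
proof
  interpret F: group "free_group X" by (rule group_free_group)
  define H where "H = {w \<in> carrier (free_group X). \<exists>k. conj_prod X R k w}"
  have R: "\<And>r. r \<in> R \<Longrightarrow> inv_word r \<in> R" "\<And>r. r \<in> R \<Longrightarrow> r \<in> words_over X \<and> reduced r"
    using assms by (auto simp: group_presentation_def cyclically_reduced_def)
  have "subgroup H (free_group X)"
  proof (rule F.subgroupI)
    show "H \<subseteq> carrier (free_group X)" by (auto simp: H_def)
    show "H \<noteq> {}"
      using conj_prod_0[of "[]" X R] F.one_closed unfolding H_def by (force simp: free_group_def)
    show "inv\<^bsub>free_group X\<^esub> a \<in> H" if "a \<in> H" for a
    proof -
      obtain k where "a \<in> carrier (free_group X)" "conj_prod X R k a"
        using \<open>a \<in> H\<close> by (auto simp: H_def)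
      then have "conj_prod X R k (inv_word a)" "inv_word a \<in> carrier (free_group X)"
        using conj_prod_inv[of X R k a] R(1) F.inv_closed[of a] by (simp_all add: inv_free_group)
      with \<open>a \<in> carrier (free_group X)\<close> show ?thesis
        unfolding H_def by (auto simp: inv_free_group)
    qed
    show "a \<otimes>\<^bsub>free_group X\<^esub> b \<in> H" if "a \<in> H" "b \<in> H" for a b
    proof -
      obtain k l where "conj_prod X R k a" "conj_prod X R l b" using \<open>a \<in> H\<close> \<open>b \<in> H\<close> by (auto simp: H_def)
      then have "conj_prod X R (k + l) (reduced_form (a @ b))"
        by (simp add: conj_prod_mult)
      moreover have "a \<otimes>\<^bsub>free_group X\<^esub> b = reduced_form (a @ b)" by (simp add: free_group_def)
      moreover have "a \<otimes>\<^bsub>free_group X\<^esub> b \<in> carrier (free_group X)"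
        using that by (intro F.m_closed) (simp_all add: H_def)
      ultimately show ?thesis unfolding H_def by auto
    qed
  qed
  moreover have "x \<otimes>\<^bsub>free_group X\<^esub> h \<otimes>\<^bsub>free_group X\<^esub> inv\<^bsub>free_group X\<^esub> x \<in> H"
    if x: "x \<in> carrier (free_group X)" and h: "h \<in> H" for x h
  proof -
    obtain k where "conj_prod X R k h" using h by (auto simp: H_def)
    then have "conj_prod X R k (x @ h @ inv_word x)"
      using x by (intro conj_prod_conj) (auto simp: free_group_def)
    then have "conj_prod X R k (reduced_form (x @ h @ inv_word x))"
      by simp
    then have "conj_prod X R k (x \<otimes>\<^bsub>free_group X\<^esub> h \<otimes>\<^bsub>free_group X\<^esub> inv\<^bsub>free_group X\<^esub> x)"
      using x by (simp add: inv_free_group) (simp add: free_group_def)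
    moreover have "x \<otimes>\<^bsub>free_group X\<^esub> h \<otimes>\<^bsub>free_group X\<^esub> inv\<^bsub>free_group X\<^esub> x \<in> carrier (free_group X)"
      using x h by (intro F.m_closed F.inv_closed) (simp_all add: H_def)
    ultimately show ?thesis unfolding H_def by blast
  qed
  ultimately have "H \<lhd> free_group X" by (simp add: F.normal_inv_iff)
  moreover have "R \<subseteq> H"
  proof
    fix r assume "r \<in> R"
    then have "conj_prod X R 1 r" using conj_prod_relator[of r R "[]" X] by simp
    with R(2)[OF \<open>r \<in> R\<close>] show "r \<in> H" by (auto simp: H_def free_group_def)
  qed
  ultimately show "relator X R w \<Longrightarrow> w \<in> words_over X \<and> reduced w \<and> (\<exists>k. conj_prod X R k w)"
  proof -
    assume "relator X R w"
    with \<open>H \<lhd> free_group X\<close> \<open>R \<subseteq> H\<close> have "w \<in> H"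
      unfolding relator_def normal_closure_def by blast
    then show ?thesis by (simp add: H_def free_group_def)
  qed
next
  interpret F: group "free_group X" by (rule group_free_group)
  assume w: "w \<in> words_over X \<and> reduced w \<and> (\<exists>k. conj_prod X R k w)"
  have "reduced_form w \<in> N" if N: "N \<lhd> free_group X" "R \<subseteq> N" and "conj_prod X R k w" for N k w
    using that(3)
  proof (induction rule: conj_prod_induct)
    case (Nil w)
    then show ?case
      using subgroup.one_closed[OF normal_imp_subgroup[OF N(1)]] by (simp add: free_group_def)
  next
    case (Cons t r k u w)
    \<comment> \<open>A conjugating word may be unreduced, hence no element of the free group; its
      reduced form replaces it.\<close>
    let ?t = "reduced_form t"
    have t: "?t \<in> carrier (free_group X)" using Cons.hyps(1) by (simp add: free_group_def reduced_form_over)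
    have "?t \<otimes>\<^bsub>free_group X\<^esub> r \<otimes>\<^bsub>free_group X\<^esub> inv\<^bsub>free_group X\<^esub> ?t \<in> N"
      using N Cons.hyps(2) t by (auto simp: F.normal_inv_iff)
    then have "(?t \<otimes>\<^bsub>free_group X\<^esub> r \<otimes>\<^bsub>free_group X\<^esub> inv\<^bsub>free_group X\<^esub> ?t) \<otimes>\<^bsub>free_group X\<^esub> reduced_form u \<in> N"
      using Cons.IH by (rule subgroup.m_closed[OF normal_imp_subgroup[OF N(1)]])
    moreover have "(?t \<otimes>\<^bsub>free_group X\<^esub> r \<otimes>\<^bsub>free_group X\<^esub> inv\<^bsub>free_group X\<^esub> ?t) \<otimes>\<^bsub>free_group X\<^esub> reduced_form u
        = reduced_form w"
    proof -
      have "reduced_form (inv_word ?t) = reduced_form (inv_word t)"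
        by (rule reduced_form_inv_word_cong) (simp add: reduced_form_id)
      then have "reduced_form ((t @ r) @ inv_word ?t @ u) = reduced_form ((t @ r) @ inv_word t @ u)"
        by (rule reduced_form_cong)
      then show ?thesis
        using Cons.hyps(4) t reduced_form_right[of "t @ r @ inv_word ?t" u]
        by (simp add: inv_free_group) (simp add: free_group_def)
    qed
    ultimately show ?case by simp
  qed
  moreover have "reduced_form w = w" using w by (simp add: reduced_form_id)
  ultimately show "relator X R w"
    unfolding relator_def normal_closure_def using w by fastforce
qed

section \<open>Corollas\<close>

lemma C_set_pos: "c \<in> C_set R k \<Longrightarrow> k \<ge> 1"
  by (cases k) auto

lemma C_set_cyclic_conjugate:
  assumes "c \<in> C_set R k" "cyclic_conjugate c' c"
  shows "c' \<in> C_set R k"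
proof -
  consider "k = 0" | "k = Suc 0" | l where "k = Suc (Suc l)" by (metis not0_implies_Suc)
  then show ?thesis
  proof cases
    case 3
    then obtain u v where "u \<in> C_set R (Suc l) \<and> v \<in> C_set R (Suc 0) \<or>
        u \<in> C_set R (Suc 0) \<and> v \<in> C_set R (Suc l)" "C_cond u v" "cyclic_conjugate c (pi_word u v)"
      using assms(1) by auto
    with cyclic_conjugate_trans[OF assms(2)] 3 show ?thesis
      unfolding 3 C_set.simps(3) by blast
  qed (use assms cyclic_conjugate_trans[OF assms(2)] in auto)
qed

lemma C_set_rotate: "a @ b \<in> C_set R k \<Longrightarrow> b @ a \<in> C_set R k"
  by (rule C_set_cyclic_conjugate) auto

lemma C_set_glueI:
  assumes "u \<in> C_set R i" "v \<in> C_set R j" "i = 1 \<or> j = 1" "C_cond u v"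
  shows "pi_word u v \<in> C_set R (i + j)"
  using assms(3)
proof
  assume i: "i = 1"
  obtain l where "j = Suc l" using C_set_pos[OF assms(2)] by (cases j) auto
  then show ?thesis using assms i by simp (metis cyclic_conjugate_refl)
next
  assume j: "j = 1"
  obtain l where "i = Suc l" using C_set_pos[OF assms(1)] by (cases i) auto
  then show ?thesis using assms j by simp (metis cyclic_conjugate_refl)
qed

text \<open>Induction that treats the two glued corollas alike, whichever of them is the single
  face.\<close>

lemma C_set_glue_induct [consumes 1, case_names base glue]:
  assumes "c \<in> C_set R k"
    and "\<And>r c. r \<in> R \<Longrightarrow> cyclic_conjugate c r \<Longrightarrow> P 1 c"
    and "\<And>i j u v c. u \<in> C_set R i \<Longrightarrow> v \<in> C_set R j \<Longrightarrow> P i u \<Longrightarrow> P j v \<Longrightarrow> C_cond u v \<Longrightarrow>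
      cyclic_conjugate c (pi_word u v) \<Longrightarrow> P (i + j) c"
  shows "P k c"
  using assms(1)
proof (induction k arbitrary: c rule: less_induct)
  case (less k)
  consider "k = 0" | "k = 1" | l where "k = Suc (Suc l)" by (metis One_nat_def not0_implies_Suc)
  then show ?case
  proof cases
    case 3
    then obtain u v where uv: "u \<in> C_set R (Suc l) \<and> v \<in> C_set R (Suc 0) \<or>
        u \<in> C_set R (Suc 0) \<and> v \<in> C_set R (Suc l)" "C_cond u v" "cyclic_conjugate c (pi_word u v)"
      using less.prems by auto
    then obtain i j where "u \<in> C_set R i" "v \<in> C_set R j" "i < k" "j < k" "i + j = k"
      using 3 by fastforce
    then show ?thesis using assms(3)[of u i v j c] less.IH uv by blast
  qed (use less.prems assms(2) in auto)
qed

lemma C_set_word: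
  assumes "group_presentation X R" "c \<in> C_set R k"
  shows "cyclically_reduced c \<and> c \<noteq> [] \<and> c \<in> words_over X \<and> conj_prod X R k c"
  using assms(2)
proof (induction rule: C_set_glue_induct)
  case (base r c)
  obtain a b where ab: "r = a @ b" "c = b @ a" using base(2) by (auto simp: cyclic_conjugate_def)
  have r: "r \<noteq> []" "cyclically_reduced r" "r \<in> words_over X"
    using assms(1) base(1) by (auto simp: group_presentation_def)
  have "conj_prod X R 1 (inv_word a @ r @ inv_word (inv_word a))"
    using base(1) r ab by (intro conj_prod_relator) auto
  then have "conj_prod X R 1 c"
    by (rule conj_prod_cong) (simp add: ab free_simps)
  with r ab show ?case using cyclically_reduced_cyclic_conjugate[OF base(2)] by auto
next
  case (glue i j u v c)
  obtain t where t: "cyclically_reduced (pi_word u v)" "reduced_form (u @ v) = t @ pi_word u v @ inv_word t"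
    by (rule pi_word_conj)
  obtain a b where ab: "pi_word u v = a @ b" "c = b @ a"
    using glue.hyps by (auto simp: cyclic_conjugate_def)
  have over: "t @ pi_word u v @ inv_word t \<in> words_over X"
    using glue.IH reduced_form_over[of "u @ v" X] t by simp
  \<comment> \<open>If \<open>c\<close> were empty, \<open>u @ v\<close> would reduce to nothing, so
    \<open>u\<close> would be the inverse of \<open>v\<close>, which \<open>C_cond\<close>
    excludes.\<close>
  have "c \<noteq> []"
  proof
    assume "c = []"
    then have "t @ pi_word u v @ inv_word t = t @ inv_word t" using ab by simp
    then have "reduced_form (u @ v) = []"
      using t(2) by (metis reduced_form_id reduced_form_inv_cancel reduced_reduced_form)
    then have "u = inv_word v"
      using glue.IH reduced_inv_word[of v]
      by (simp add: reduced_form_eq_Nil_iff reduced_form_id cyclically_reduced_def)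
    then show False using glue.hyps by (simp add: C_cond_def)
  qed
  \<comment> \<open>Conjugation by \<open>t\<close> accounts for the cyclic reduction in
    \<open>pi_word\<close>, conjugation by \<open>a\<close> for the rotation to
    \<open>c\<close>.\<close>
  moreover have "conj_prod X R (i + j) (inv_word (t @ a) @ (u @ v) @ inv_word (inv_word (t @ a)))"
    using glue.IH over ab by (intro conj_prod_conj conj_prod_mult) auto
  then have "conj_prod X R (i + j) c"
  proof (rule conj_prod_cong)
    have "reduced_form (inv_word (t @ a) @ (u @ v) @ t @ a) =
      reduced_form (inv_word (t @ a) @ (t @ pi_word u v @ inv_word t) @ t @ a)"
      by (rule reduced_form_cong) (metis t(2) reduced_form_id reduced_reduced_form)
    then show "reduced_form (inv_word (t @ a) @ (u @ v) @ inv_word (inv_word (t @ a))) = reduced_form c"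
      by (simp add: ab free_simps)
  qed
  moreover have "cyclically_reduced c"
    using t(1) glue.hyps cyclically_reduced_cyclic_conjugate by blast
  ultimately show ?case using over ab by auto
qed

section \<open>Splitting a face off at a boundary letter\<close>

text \<open>The rotation \<open>x b a\<close> of \<open>w\<close> is the product of the face
  \<open>x r\<close> and of \<open>r^-1 b a\<close>, which carries the other \<open>k - 1\<close>
  faces. Conjugators over \<open>UNIV\<close> spare side conditions on the alphabet.\<close>

definition peelable :: "'a word set \<Rightarrow> nat \<Rightarrow> 'a word \<Rightarrow> bool" where
  "peelable R k w \<longleftrightarrow> (\<forall>a x b. w = a @ x # b \<longrightarrow>
     (\<exists>r. x # r \<in> C_set R 1 \<and> conj_prod UNIV R (k - 1) (inv_word r @ b @ a)))"

text \<open>The face is split off the factor containing the letter; the other factor enters whole,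
  as a conjugate: \<open>r^-1 e v a = (r^-1 e a) (a^-1 v a)\<close>.\<close>

lemma peelable_mult:
  assumes "peelable R i u" "peelable R j v" "conj_prod UNIV R i u" "conj_prod UNIV R j v" "i \<ge> 1" "j \<ge> 1"
  shows "peelable R (i + j) (u @ v)"
  unfolding peelable_def
proof (intro allI impI)
  fix a x b assume "u @ v = a @ x # b"
  then consider e where "u = a @ x # e" "b = e @ v" | e where "v = e @ x # b" "a = u @ e"
    by (auto elim: letter_in_append)
  then show "\<exists>r. x # r \<in> C_set R 1 \<and> conj_prod UNIV R (i + j - 1) (inv_word r @ b @ a)"
  proof cases
    case 1
    then obtain r where r: "x # r \<in> C_set R 1" "conj_prod UNIV R (i - 1) (inv_word r @ e @ a)"
      using assms(1) unfolding peelable_def by blast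
    have "conj_prod UNIV R (i - 1 + j) ((inv_word r @ e @ a) @ (inv_word a @ v @ inv_word (inv_word a)))"
      using r assms by (intro conj_prod_mult conj_prod_conj) auto
    then have "conj_prod UNIV R (i + j - 1) (inv_word r @ b @ a)"
      using \<open>i \<ge> 1\<close> 1 by (auto elim!: conj_prod_cong simp: free_simps)
    with r show ?thesis by blast
  next
    case 2
    then obtain r where r: "x # r \<in> C_set R 1" "conj_prod UNIV R (j - 1) (inv_word r @ b @ e)"
      using assms(2) unfolding peelable_def by blast
    have "conj_prod UNIV R (j - 1 + i) ((inv_word r @ b @ e) @ (inv_word e @ u @ inv_word (inv_word e)))"
      using r assms by (intro conj_prod_mult conj_prod_conj) auto
    then have "conj_prod UNIV R (i + j - 1) (inv_word r @ b @ a)"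
      using \<open>j \<ge> 1\<close> 2 by (auto elim!: conj_prod_cong simp: free_simps add.commute)
    with r show ?thesis by blast
  qed
qed

lemma peelable_reduced_form:
  assumes "peelable R k w"
  shows "peelable R k (reduced_form w)"
  unfolding peelable_def
proof (intro allI impI)
  fix a x b assume "reduced_form w = a @ x # b"
  then obtain a' b' where w: "w = a' @ x # b'" "reduced_form a' = a" "reduced_form b' = b"
    using letter_of_reduced_form by metis
  then obtain r where r: "x # r \<in> C_set R 1" "conj_prod UNIV R (k - 1) (inv_word r @ b' @ a')"
    using assms unfolding peelable_def by blast
  have "reduced_form (inv_word r @ b' @ a') = reduced_form (inv_word r @ b @ a)"
    using w reduced_form_cong[of b' b "inv_word r" a'] reduced_form_right[of "inv_word r @ b" a']
    by (metis append_assoc reduced_form_id reduced_reduced_form)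
  with r show "\<exists>r. x # r \<in> C_set R 1 \<and> conj_prod UNIV R (k - 1) (inv_word r @ b @ a)"
    using conj_prod_cong by blast
qed

lemma peelable_conjD:
  assumes "peelable R k (t @ w @ inv_word t)"
  shows "peelable R k w"
  unfolding peelable_def
proof (intro allI impI)
  fix a x b assume "w = a @ x # b"
  then have "t @ w @ inv_word t = (t @ a) @ x # b @ inv_word t" by simp
  then obtain r where r: "x # r \<in> C_set R 1" "conj_prod UNIV R (k - 1) (inv_word r @ (b @ inv_word t) @ t @ a)"
    using assms unfolding peelable_def by metis
  from r(2) have "conj_prod UNIV R (k - 1) (inv_word r @ b @ a)"
    by (rule conj_prod_cong) (simp add: free_simps)
  with r(1) show "\<exists>r. x # r \<in> C_set R 1 \<and> conj_prod UNIV R (k - 1) (inv_word r @ b @ a)" by blast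
qed

lemma peelable_cyclic_conjugate:
  assumes "peelable R k w" "cyclic_conjugate w' w"
  shows "peelable R k w'"
  unfolding peelable_def
proof (intro allI impI)
  fix a x b assume eq: "w' = a @ x # b"
  obtain p q where pq: "w = p @ q" "w' = q @ p" using assms(2) by (auto simp: cyclic_conjugate_def)
  with eq consider e where "q = a @ x # e" "b = e @ p" | e where "p = e @ x # b" "a = q @ e"
    by (auto elim: letter_in_append)
  then show "\<exists>r. x # r \<in> C_set R 1 \<and> conj_prod UNIV R (k - 1) (inv_word r @ b @ a)"
  proof cases
    case 1
    with pq have "w = (p @ a) @ x # e" by simp
    with assms(1) 1 show ?thesis unfolding peelable_def by fastforce
  next
    case 2
    with pq have "w = e @ x # (b @ q)" by simp
    with assms(1) 2 show ?thesis unfolding peelable_def by fastforce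
  qed
qed

text \<open>Every letter on the boundary of a corolla lies on one of its faces, so that face can be
  split off there.\<close>

lemma peelable_C_set:
  assumes "group_presentation X R" "c \<in> C_set R k"
  shows "peelable R k c"
  using assms(2)
proof (induction rule: C_set_glue_induct)
  case (base r c)
  have "c \<in> C_set R 1" using base by auto
  then show ?case
    unfolding peelable_def
    by (metis C_set_rotate append_Cons conj_prod_0 diff_self_eq_0 reduced_form_inverse)
next
  case (glue i j u v c)
  have U: "group_presentation UNIV R" using assms(1) by (auto simp: group_presentation_def)
  have "peelable R (i + j) (reduced_form (u @ v))"
    using glue C_set_word[OF U] C_set_pos by (intro peelable_reduced_form peelable_mult) blast+
  moreover obtain t where "reduced_form (u @ v) = t @ pi_word u v @ inv_word t"
    using pi_word_conj by blast
  ultimately have "peelable R (i + j) (pi_word u v)"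
    using peelable_conjD by metis
  then show ?case using glue.hyps peelable_cyclic_conjugate by blast
qed

text \<open>If the boundaries of two faces cancel along an arc containing the base point, moving the
  base point to the start of the longest common prefix \<open>p\<close> of \<open>u\<close> and \<open>v\<^sup>-\<^sup>1\<close> makes the third
  alternative of \<open>C_cond\<close> hold, unless one boundary is swallowed entirely.\<close>

lemma C_set_glue:
  assumes "u \<in> C_set R i" "v \<in> C_set R j" "i = 1 \<or> j = 1"
    and ne: "u \<noteq> []" "v \<noteq> []" and cancel: "last u = inv_letter (hd v)"
    and nontriv: "reduced_form (u @ v) \<noteq> []"
  shows "\<exists>h c. c \<in> C_set R (i + j) \<and> reduced_form (u @ v) = reduced_form (h @ c @ inv_word h)"
proof -
  define p where "p = longest_common_prefix u (inv_word v)"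
  obtain u1 where u: "u = p @ u1"
    unfolding p_def using longest_common_prefix_prefix1 by (metis prefixE)
  obtain v1' where v': "inv_word v = p @ v1'"
    unfolding p_def using longest_common_prefix_prefix2 by (metis prefixE)
  define v1 where "v1 = inv_word v1'"
  have "inv_word (inv_word v) = v1 @ inv_word p" using v' by (simp add: v1_def)
  then have v: "v = v1 @ inv_word p" by simp
  have diff: "hd u1 \<noteq> hd v1'" if "u1 \<noteq> []" "v1' \<noteq> []"
  proof
    assume "hd u1 = hd v1'"
    with that have "prefix (p @ [hd u1]) u" "prefix (p @ [hd u1]) (inv_word v)"
      unfolding u v' by (cases u1; cases v1'; simp)+
    then have "prefix (p @ [hd u1]) p"
      using longest_common_prefix_max_prefix[of "p @ [hd u1]" u "inv_word v"] by (simp add: p_def)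
    then show False by simp
  qed
  \<comment> \<open>The words \<open>u'\<close> and \<open>v'\<close> will be rotations of
    \<open>u\<close> and \<open>v\<close>, and \<open>s\<close> is the path along which the base
    point moves.\<close>
  let ?goal = "\<lambda>s u' v'. u' \<in> C_set R i \<and> v' \<in> C_set R j \<and> C_cond u' v' \<and>
    reduced_form (u @ v) = reduced_form (s @ (u' @ v') @ inv_word s)"
  have not_inv: "u' \<noteq> inv_word v'" if "reduced_form (u @ v) = reduced_form (s @ (u' @ v') @ inv_word s)" for s u' v'
    using that nontriv by (auto simp: free_simps)
  have "\<exists>s u' v'. ?goal s u' v'"
  proof -
    consider "u1 = []" | "v1 = []" | "u1 \<noteq> []" "v1 \<noteq> []" by blast
    then show ?thesis
    proof cases
      case 1
      \<comment> \<open>Here \<open>u = p\<close> is swallowed: \<open>v = v1 u^-1\<close> is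
        rotated so as to begin with \<open>u^-1\<close>.\<close>
      have "reduced_form (u @ v) = reduced_form (u @ (u @ inv_word p @ v1) @ inv_word u)"
        by (simp add: u v 1 free_simps)
      then have "?goal u u (inv_word p @ v1)"
        using assms C_set_rotate[of v1 "inv_word p"] 1 not_inv u v by (auto simp: C_cond_def)
      then show ?thesis by blast
    next
      case 2
      \<comment> \<open>Here \<open>v = p^-1\<close> is swallowed: \<open>u\<close> is rotated so as
        to end with \<open>p = v^-1\<close>.\<close>
      have "reduced_form (u @ v) = reduced_form (p @ ((u1 @ p) @ v) @ inv_word p)"
        by (simp add: u v 2 free_simps)
      then have "?goal p (u1 @ p) v"
        using assms C_set_rotate[of p u1] 2 not_inv u v by (auto simp: C_cond_def suffix_def)
      then show ?thesis by blast
    next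
      case 3
      have eq: "reduced_form (u @ v) = reduced_form (p @ ((u1 @ p) @ inv_word p @ v1) @ inv_word p)"
        by (simp add: u v free_simps)
      have "v1' \<noteq> []" using 3 by (auto simp: v1_def)
      \<comment> \<open>By maximality of \<open>p\<close>, the cancelling arc does not continue
        beyond the new base point.\<close>
      with 3 diff have "hd u1 \<noteq> inv_letter (last v1)"
        by (simp add: v1_def last_inv_word)
      \<comment> \<open>For non-empty \<open>p\<close> the letters at the seam come from
        \<open>p p^-1\<close>; for empty \<open>p\<close> nothing has moved and
        \<open>cancel\<close> applies.\<close>
      moreover have "last (u1 @ p) = inv_letter (hd (inv_word p @ v1))"
        using cancel 3 u v by (cases "p = []") (auto simp: hd_inv_word)
      ultimately have "?goal p (u1 @ p) (inv_word p @ v1)"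
        using assms C_set_rotate[of p u1] C_set_rotate[of v1 "inv_word p"] 3 not_inv[OF eq] u v eq
        by (auto simp: C_cond_def)
      then show ?thesis by blast
    qed
  qed
  then obtain s u' v' where g: "?goal s u' v'" by blast
  obtain t where t: "reduced_form (u' @ v') = t @ pi_word u' v' @ inv_word t"
    using pi_word_conj by blast
  have "pi_word u' v' \<in> C_set R (i + j)" using g assms(3) C_set_glueI by blast
  moreover have "reduced_form (u @ v) = reduced_form ((s @ t) @ pi_word u' v' @ inv_word (s @ t))"
  proof -
    have "reduced_form (u' @ v') = reduced_form (t @ pi_word u' v' @ inv_word t)"
      by (metis t reduced_form_id reduced_reduced_form)
    then have "reduced_form (s @ (u' @ v') @ inv_word s) =
      reduced_form (s @ (t @ pi_word u' v' @ inv_word t) @ inv_word s)"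
      by (rule reduced_form_cong)
    with g show ?thesis by simp
  qed
  ultimately show ?thesis by blast
qed

section \<open>Tree-like arrangements of corollas\<close>

text \<open>\<open>cactus R n m w\<close>: the word \<open>w\<close> is the boundary word of a planar tree-like arrangement of edges
  and of corollas with altogether \<open>n\<close> faces; \<open>m\<close> is the sum of \<open>3 ^ k\<close> over the corollas, where \<open>k\<close>
  is their number of faces.\<close>

inductive cactus :: "'a word set \<Rightarrow> nat \<Rightarrow> nat \<Rightarrow> 'a word \<Rightarrow> bool" for R where
  Nil: "cactus R 0 0 []"
| edge: "cactus R n m (a @ b) \<Longrightarrow> cactus R n m (a @ [x, inv_letter x] @ b)"
| corolla: "cactus R n m (a @ b) \<Longrightarrow> c \<in> C_set R k \<Longrightarrow> cactus R (n + k) (m + 3 ^ k) (a @ c @ b)"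

lemma cactus_insert:
  assumes "cactus R i j z" "cactus R n m (a @ b)"
  shows "cactus R (n + i) (m + j) (a @ z @ b)"
  using assms(1)
proof induction
  case (edge i j p q x)
  then show ?case using cactus.edge[of R "n + i" "m + j" "a @ p" "q @ b" x] by simp
next
  case (corolla i j p q c k)
  then show ?case
    using cactus.corolla[of R "n + i" "m + j" "a @ p" "q @ b" c k] by (simp add: add.assoc)
qed (use assms(2) in simp)

lemma cactus_append: "cactus R n m u \<Longrightarrow> cactus R i j v \<Longrightarrow> cactus R (n + i) (m + j) (u @ v)"
  using cactus_insert[of R i j v n m u "[]"] by simp

lemma cactus_C_set: "c \<in> C_set R k \<Longrightarrow> cactus R k (3 ^ k) c"
  using cactus.corolla[of R 0 0 "[]" "[]" c k] cactus.Nil[of R] by simp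

lemma cactus_insert_path: "cactus R n m (a @ b) \<Longrightarrow> cactus R n m (a @ t @ inv_word t @ b)"
proof (induction t arbitrary: a b)
  case (Cons x t)
  then have "cactus R n m ((a @ [x]) @ t @ inv_word t @ [inv_letter x] @ b)"
    using Cons.IH[of "a @ [x]" "[inv_letter x] @ b"] cactus.edge[OF Cons.prems] by simp
  then show ?case by simp
qed simp

lemma cactus_conj: "cactus R n m z \<Longrightarrow> cactus R n m (s @ z @ inv_word s)"
  using cactus_insert[of R n m z 0 0 s "inv_word s"] cactus_insert_path[of R 0 0 "[]" "[]" s] cactus.Nil[of R]
  by simp

text \<open>Bounds the quantity that improvements increase. A sum of two numbers \<ge> 3 is at most
  their product; the exponent \<open>Suc n\<close> makes the first of them at least 3 even without
  faces.\<close>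

lemma cactus_bound: "cactus R n m w \<Longrightarrow> m \<le> 3 ^ Suc n"
proof (induction rule: cactus.induct)
  case (corolla n m a b c k)
  obtain l where k: "k = Suc l" using C_set_pos[OF corolla.hyps(2)] by (cases k) auto
  have "x + y \<le> x * y" if "x \<ge> 3" "y \<ge> 3" for x y :: nat
  proof -
    have "x + y \<le> 2 * max x y" by simp
    also have "\<dots> \<le> min x y * max x y" using that by (intro mult_right_mono) auto
    also have "\<dots> = x * y" by (simp add: min_def max_def)
    finally show ?thesis .
  qed
  from this[of "3 ^ Suc n" "3 ^ k"] corolla.IH show ?case by (simp add: k power_add)
qed auto

text \<open>Each factor \<open>t r t^-1\<close> is a lollipop with a single face, contributing
  \<open>3 ^ 1\<close> to the weight.\<close>

lemma conj_prod_cactus: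
  assumes "conj_prod X R k w"
  shows "\<exists>z. cactus R k (3 * k) z \<and> reduced_form z = reduced_form w"
  using assms
proof (induction rule: conj_prod_induct)
  case (Nil w)
  then show ?case using cactus.Nil by (intro exI[of _ "[]"]) auto
next
  case (Cons t r k u w)
  then obtain z where z: "cactus R k (3 * k) z" "reduced_form z = reduced_form u" by blast
  have "r \<in> C_set R 1" using Cons.hyps(2) by (auto intro: bexI[of _ r])
  then have "cactus R (1 + k) (3 ^ 1 + 3 * k) ((t @ r @ inv_word t) @ z)"
    using z by (intro cactus_append cactus_conj cactus_C_set)
  moreover have "reduced_form ((t @ r @ inv_word t) @ z) = reduced_form w"
    using Cons.hyps(4) z(2) reduced_form_cong[of z u "t @ r @ inv_word t" "[]"] by simp
  ultimately show ?case by (intro exI[of _ "(t @ r @ inv_word t) @ z"]) simp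
qed

section \<open>Improving a cactus\<close>

text \<open>Progress is lexicographic: fewer faces, or equally many in a heavier arrangement. Only
  the reduced form of the boundary is kept, so the word itself may grow.\<close>

definition improvable :: "'a word set \<Rightarrow> nat \<Rightarrow> nat \<Rightarrow> 'a word \<Rightarrow> bool" where
  "improvable R n m w \<longleftrightarrow> (\<exists>n' m' z. cactus R n' m' z \<and> reduced_form z = reduced_form w \<and>
     (n' < n \<or> n' = n \<and> m < m'))"

lemma improvable_cong: "improvable R n m u \<Longrightarrow> reduced_form u = reduced_form v \<Longrightarrow> improvable R n m v"
  by (simp add: improvable_def)

text \<open>The improved cactus need not retain the place between \<open>a\<close> and
  \<open>b\<close>; hence \<open>z\<close> is attached at the end, by
  \<open>a z b = (a b) (b^-1 z b)\<close>.\<close>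

lemma improvable_insert:
  assumes "improvable R n m (a @ b)" "cactus R i j z"
  shows "improvable R (n + i) (m + j) (a @ z @ b)"
proof -
  obtain n' m' w where w: "cactus R n' m' w" "reduced_form w = reduced_form (a @ b)"
    "n' < n \<or> n' = n \<and> m < m'"
    using assms(1) by (auto simp: improvable_def)
  have "cactus R (n' + i) (m' + j) (w @ (inv_word b @ z @ inv_word (inv_word b)))"
    using w assms(2) by (intro cactus_append cactus_conj)
  moreover have "reduced_form (w @ inv_word b @ z @ b) = reduced_form (a @ z @ b)"
    using reduced_form_cong[OF w(2), of "[]" "inv_word b @ z @ b"] by (simp add: free_simps)
  ultimately show ?thesis
    unfolding improvable_def using w(3)
    by (intro exI[of _ "n' + i"] exI[of _ "m' + j"] exI[of _ "w @ inv_word b @ z @ b"]) auto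
qed

lemma insert_improvable:
  assumes "cactus R n m (a @ b)" "improvable R i j z"
  shows "improvable R (n + i) (m + j) (a @ z @ b)"
proof -
  obtain n' m' w where w: "cactus R n' m' w" "reduced_form w = reduced_form z"
    "n' < i \<or> n' = i \<and> j < m'"
    using assms(2) by (auto simp: improvable_def)
  then show ?thesis
    unfolding improvable_def using cactus_insert[OF w(1) assms(1)] reduced_form_cong[OF w(2)]
    by (intro exI[of _ "n + n'"] exI[of _ "m + m'"] exI[of _ "a @ w @ b"]) auto
qed

lemma improvable_conj: "improvable R n m z \<Longrightarrow> improvable R n m (s @ z @ inv_word s)"
  using cactus_insert_path[of R 0 0 "[]" "[]" s] cactus.Nil[of R] insert_improvable[of R 0 0 s "inv_word s"]
  by auto

text \<open>The two possible outcomes of a fold. The disjunction survives the insertion of further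
  edges and corollas, as inductions over \<open>cactus\<close> require.\<close>

definition cactus_or_better :: "'a word set \<Rightarrow> nat \<Rightarrow> nat \<Rightarrow> 'a word \<Rightarrow> bool" where
  "cactus_or_better R n m w \<longleftrightarrow> cactus R n m w \<or> improvable R n m w"

lemma cactus_or_better_edge:
  assumes "cactus_or_better R n m (a @ b)"
  shows "cactus_or_better R n m (a @ [x, inv_letter x] @ b)"
  using assms unfolding cactus_or_better_def
proof
  assume "improvable R n m (a @ b)"
  then have "improvable R n m (a @ [x, inv_letter x] @ b)"
    by (rule improvable_cong) (simp add: reduced_form_delete)
  then show "cactus R n m (a @ [x, inv_letter x] @ b) \<or> improvable R n m (a @ [x, inv_letter x] @ b)" ..
qed (intro disjI1 cactus.edge)

lemma cactus_or_better_corolla: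
  assumes "cactus_or_better R n m (a @ b)" "c \<in> C_set R k"
  shows "cactus_or_better R (n + k) (m + 3 ^ k) (a @ c @ b)"
  using assms cactus.corolla[of R n m a b c k] improvable_insert[OF _ cactus_C_set[OF assms(2)]]
  unfolding cactus_or_better_def by blast

text \<open>Two corollas with a common edge: split off a face of the smaller one at this edge, glue it to
  the larger one and scatter the remaining faces as single ones.\<close>

lemma glue_improvable:
  assumes "group_presentation X R" "u @ [x] \<in> C_set R k" "inv_letter x # v \<in> C_set R l"
  shows "improvable R (k + l) (3 ^ k + 3 ^ l) (u @ v)"
proof -
  have pos: "k \<ge> 1" "l \<ge> 1" using assms C_set_pos by auto
  \<comment> \<open>Base 3 makes the gain strict: \<open>3 ^ a + 3 ^ b\<close> is at most
    \<open>2 * 3 ^ b\<close>. The summand \<open>c\<close> stands for the scattered faces.\<close>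
  have pow: "3 ^ a + 3 ^ b < 3 ^ Suc b + (c::nat)" if "a \<le> b" for a b c :: nat
  proof -
    have "(3::nat) ^ a \<le> 3 ^ b" using that by simp
    moreover have "(0::nat) < 3 ^ b" by simp
    ultimately show ?thesis unfolding power_Suc by linarith
  qed
  show ?thesis
  proof (cases "l \<le> k")
    case True
    obtain r where r: "inv_letter x # r \<in> C_set R 1" "conj_prod UNIV R (l - 1) (inv_word r @ v)"
      using peelable_C_set[OF assms(1,3)] unfolding peelable_def by (metis append_Nil append_Nil2)
    obtain z where z: "cactus R (l - 1) (3 * (l - 1)) z" "reduced_form z = reduced_form (inv_word r @ v)"
      using conj_prod_cactus[OF r(2)] by blast
    let ?g = "(u @ [x]) @ inv_letter x # r"
    \<comment> \<open>This is \<open>u v = (u x) (x^-1 r) (r^-1 v)\<close>: the larger corolla, the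
      face split off, and the rest \<open>z\<close>.\<close>
    have eq: "reduced_form (u @ v) = reduced_form (?g @ z)"
    proof -
      have "reduced_form (?g @ z) = reduced_form (u @ r @ z)"
        using reduced_form_delete[of u x "r @ z"] by simp
      also have "\<dots> = reduced_form (u @ r @ inv_word r @ v)"
        using reduced_form_cong[OF z(2), of "u @ r" "[]"] by simp
      also have "\<dots> = reduced_form (u @ v)" by (simp add: free_simps)
      finally show ?thesis by simp
    qed
    show ?thesis
    proof (cases "reduced_form ?g = []")
      case True
      \<comment> \<open>The larger corolla and the face annihilate each other, so only
        \<open>l - 1\<close> faces remain.\<close>
      then have "reduced_form (u @ v) = reduced_form z"
        using eq reduced_form_left[of ?g z] by simp
      then show ?thesis unfolding improvable_def
        using z(1) pos by (intro exI[of _ "l - 1"] exI[of _ "3 * (l - 1)"] exI[of _ z]) auto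
    next
      case False
      then obtain h c where hc: "c \<in> C_set R (k + 1)" "reduced_form ?g = reduced_form (h @ c @ inv_word h)"
        using C_set_glue[OF assms(2) r(1)] by auto
      have "cactus R (k + 1 + (l - 1)) (3 ^ (k + 1) + 3 * (l - 1)) ((h @ c @ inv_word h) @ z)"
        using hc z by (intro cactus_append cactus_conj cactus_C_set)
      moreover have "reduced_form ((h @ c @ inv_word h) @ z) = reduced_form (u @ v)"
        using reduced_form_cong[OF hc(2), of "[]" z] eq by simp
      moreover have "3 ^ k + 3 ^ l < 3 ^ (k + 1) + 3 * (l - 1)"
        using pow[OF True] by (simp add: add.commute)
      ultimately show ?thesis unfolding improvable_def
        using pos by (intro exI[of _ "k + 1 + (l - 1)"] exI[of _ "3 ^ (k + 1) + 3 * (l - 1)"]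
            exI[of _ "(h @ c @ inv_word h) @ z"]) auto
    qed
  next
    case False
    \<comment> \<open>Mirror case: the face is split off the left corolla, rotated to start at the
      common edge.\<close>
    have "[x] @ u \<in> C_set R k" using assms(2) by (rule C_set_rotate)
    then obtain r where r: "x # r \<in> C_set R 1" "conj_prod UNIV R (k - 1) (inv_word r @ u)"
      using peelable_C_set[OF assms(1), of "x # u"] unfolding peelable_def
      by (metis append_Cons append_Nil append_Nil2)
    obtain z where z: "cactus R (k - 1) (3 * (k - 1)) z" "reduced_form z = reduced_form (inv_word r @ u)"
      using conj_prod_cactus[OF r(2)] by blast
    have r': "r @ [x] \<in> C_set R 1" using C_set_rotate[of "[x]" r] r(1) by (simp only: append_Cons append_Nil)
    let ?g = "(r @ [x]) @ inv_letter x # v"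
    \<comment> \<open>With \<open>z = r^-1 u\<close>, the rest moves to the front as the conjugate
      \<open>r z r^-1 = u r^-1\<close>.\<close>
    have eq: "reduced_form (u @ v) = reduced_form ((r @ z @ inv_word r) @ ?g)"
    proof -
      have "reduced_form ((r @ z @ inv_word r) @ ?g) = reduced_form (r @ z @ inv_word r @ r @ v)"
        using reduced_form_delete[of "r @ z @ inv_word r @ r" x v] by simp
      also have "\<dots> = reduced_form (r @ z @ v)" by (simp add: free_simps)
      also have "\<dots> = reduced_form (r @ inv_word r @ u @ v)"
        using reduced_form_cong[OF z(2), of r v] by simp
      also have "\<dots> = reduced_form (u @ v)" by (simp add: free_simps)
      finally show ?thesis by simp
    qed
    show ?thesis
    proof (cases "reduced_form ?g = []")
      case True
      then have "reduced_form (u @ v) = reduced_form (r @ z @ inv_word r)"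
        using eq reduced_form_cong[of ?g "[]" "r @ z @ inv_word r" "[]"] by simp
      then show ?thesis unfolding improvable_def
        using cactus_conj[OF z(1), of r] pos
        by (intro exI[of _ "k - 1"] exI[of _ "3 * (k - 1)"] exI[of _ "r @ z @ inv_word r"]) auto
    next
      case nontriv: False
      then obtain h c where hc: "c \<in> C_set R (1 + l)" "reduced_form ?g = reduced_form (h @ c @ inv_word h)"
        using C_set_glue[OF r' assms(3)] by auto
      have "cactus R (k - 1 + (1 + l)) (3 * (k - 1) + 3 ^ (1 + l)) ((r @ z @ inv_word r) @ (h @ c @ inv_word h))"
        using hc z by (intro cactus_append cactus_conj cactus_C_set)
      moreover have "reduced_form ((r @ z @ inv_word r) @ (h @ c @ inv_word h)) = reduced_form (u @ v)"
        using reduced_form_cong[OF hc(2), of "r @ z @ inv_word r" "[]"] eq by simp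
      moreover have "3 ^ k + 3 ^ l < 3 * (k - 1) + 3 ^ (1 + l)"
        using pow[of k l] False by (simp add: add.commute)
      ultimately show ?thesis unfolding improvable_def
        using pos by (intro exI[of _ "k - 1 + (1 + l)"] exI[of _ "3 * (k - 1) + 3 ^ (1 + l)"]
            exI[of _ "(r @ z @ inv_word r) @ (h @ c @ inv_word h)"]) auto
    qed
  qed
qed

lemma letter_in_append3:
  assumes "p @ B @ q = a @ x # b"
  obtains (left) e where "p = a @ x # e" "b = e @ B @ q"
  | (middle) e f where "B = e @ x # f" "a = p @ e" "b = f @ q"
  | (right) e where "q = e @ x # b" "a = p @ B @ e"
  using assms
proof (cases rule: letter_in_append)
  case (right e)
  from right(1) show thesis
  proof (cases rule: letter_in_append)
    case (left f)
    with right that(2) show thesis by blast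
  next
    case (right f)
    with \<open>a = p @ e\<close> that(3) show thesis by simp
  qed
qed (use that(1) in blast)

text \<open>Folding a corolla onto an adjacent boundary edge: if this edge belongs to no corolla, it
  becomes part of the boundary of the new one; otherwise the two corollas are glued.\<close>

lemma cactus_attach:
  assumes "group_presentation X R" "inv_letter x # c \<in> C_set R k" "cactus R n m w" "w = a @ x # b"
  shows "cactus_or_better R (n + k) (m + 3 ^ k) (a @ c @ b)"
  using assms(3,4)
proof (induction arbitrary: a b)
  case (edge n m p q y)
  from edge.prems show ?case
  proof (cases rule: letter_in_append3)
    case (left e)
    with edge.IH[of a "e @ q"] show ?thesis
      using cactus_or_better_edge[of R "n + k" "m + 3 ^ k" "a @ c @ e" q y] by simp
  next
    case (right e)
    with edge.IH[of "p @ e" b] show ?thesis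
      using cactus_or_better_edge[of R "n + k" "m + 3 ^ k" p "e @ c @ b" y] by simp
  next
    case (middle e f)
    \<comment> \<open>The letter \<open>x\<close> is one side of the spur. Folding uses up this
      side, and the other side closes \<open>c\<close> to a rotation of the given corolla.\<close>
    then consider "e = []" "y = x" "f = [inv_letter x]" | "e = [y]" "x = inv_letter y" "f = []"
      by (auto simp: Cons_eq_append_conv)
    then show ?thesis
    proof cases
      case 1
      have "c @ [inv_letter x] \<in> C_set R k" using C_set_rotate[of "[inv_letter x]" c] assms(2) by simp
      from cactus.corolla[OF edge.hyps this] middle 1 show ?thesis
        by (simp add: cactus_or_better_def)
    next
      case 2
      from cactus.corolla[OF edge.hyps assms(2)] middle 2 show ?thesis
        by (simp add: cactus_or_better_def)
    qed
  qed
next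
  case (corolla n m p q c2 l)
  from corolla.prems show ?case
  proof (cases rule: letter_in_append3)
    case (left e)
    with corolla.IH[of a "e @ q"] show ?thesis
      using cactus_or_better_corolla[of R "n + k" "m + 3 ^ k" "a @ c @ e" q c2 l] corolla.hyps
      by (simp add: ac_simps)
  next
    case (right e)
    with corolla.IH[of "p @ e" b] show ?thesis
      using cactus_or_better_corolla[of R "n + k" "m + 3 ^ k" p "e @ c @ b" c2 l] corolla.hyps
      by (simp add: ac_simps)
  next
    case (middle e f)
    \<comment> \<open>The second corolla is rotated to end at the common edge; conjugation by
      \<open>f^-1\<close> later restores the base point.\<close>
    have "(f @ e) @ [x] \<in> C_set R l"
      using corolla.hyps(2) middle C_set_rotate[of "e @ [x]" f] by simp
    then have "improvable R (l + k) (3 ^ l + 3 ^ k) ((f @ e) @ c)"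
      using glue_improvable[OF assms(1) _ assms(2)] by blast
    then have "improvable R (l + k) (3 ^ l + 3 ^ k) (inv_word f @ ((f @ e) @ c) @ f)"
      using improvable_conj[of R _ _ _ "inv_word f"] by fastforce
    then have "improvable R (l + k) (3 ^ l + 3 ^ k) (e @ c @ f)"
      by (rule improvable_cong) (simp add: free_simps)
    with corolla.hyps(1) have "improvable R (n + (l + k)) (m + (3 ^ l + 3 ^ k)) (p @ (e @ c @ f) @ q)"
      by (rule insert_improvable)
    then show ?thesis using middle by (simp add: add.assoc cactus_or_better_def)
  qed
qed simp

text \<open>Induction on the construction. A pair away from the piece inserted last is left to the
  induction hypothesis. A pair meeting a spur is removed along with it, up to renaming equal
  letters; one meeting a corolla is folded by \<open>cactus_attach\<close>.\<close>

lemma cactus_cancel: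
  assumes "group_presentation X R" "cactus R n m w" "w = a @ x # inv_letter x # b"
  shows "cactus_or_better R n m (a @ b)"
  using assms(2,3)
proof (induction arbitrary: a b)
  case (edge n m p q y)
  from edge.prems show ?case
  proof (cases rule: letter_in_append3)
    case (left e)
    show ?thesis
    proof (cases e)
      case Nil
      with left have "p = a @ [x]" "y = inv_letter x" "b = inv_letter y # q" by simp_all
      then have "a @ b = p @ q" by simp
      with edge.hyps show ?thesis unfolding cactus_or_better_def by simp
    next
      case (Cons z e')
      with left edge.IH[of a "e' @ q"] show ?thesis
        using cactus_or_better_edge[of R n m "a @ e'" q y] by simp
    qed
  next
    case (right e)
    with edge.IH[of "p @ e" b] show ?thesis
      using cactus_or_better_edge[of R n m p "e @ b" y] by simp
  next
    case (middle e f)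
    then consider "e = []" "y = x" "f = [inv_letter x]" | "e = [y]" "x = inv_letter y" "f = []"
      by (auto simp: Cons_eq_append_conv)
    then have "a @ b = p @ q"
    proof cases
      case 1
      with middle(2,3) show ?thesis by simp
    next
      case 2
      with middle(3) have "q = y # b" by simp
      with 2 middle(2) show ?thesis by simp
    qed
    with edge.hyps show ?thesis unfolding cactus_or_better_def by simp
  qed
next
  case (corolla n m p q c k)
  have c: "reduced c" "c \<noteq> []"
    using C_set_word[OF assms(1) corolla.hyps(2)] by (auto simp: cyclically_reduced_def)
  from corolla.prems show ?case
  proof (cases rule: letter_in_append3)
    case (left e)
    show ?thesis
    proof (cases e)
      case Nil
      with left c obtain c' where c': "c = inv_letter x # c'" "b = c' @ q"
        by (cases c) auto
      with cactus_attach[OF assms(1) _ corolla.hyps(1), of x c' k a q] corolla.hyps(2) left Nil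
      show ?thesis by simp
    next
      case (Cons z e')
      with left corolla.IH[of a "e' @ q"] show ?thesis
        using cactus_or_better_corolla[of R n m "a @ e'" q c k] corolla.hyps by simp
    qed
  next
    case (right e)
    with corolla.IH[of "p @ e" b] show ?thesis
      using cactus_or_better_corolla[of R n m p "e @ b" c k] corolla.hyps by simp
  next
    case (middle e f)
    \<comment> \<open>The boundary of a corolla is reduced, so it cannot contain both letters of the
      pair.\<close>
    have "f = []"
    proof (rule ccontr)
      assume "f \<noteq> []"
      with middle obtain f' where "c = e @ x # inv_letter x # f'" by (cases f) auto
      with c show False using reduced_no_cancelling_pair by blast
    qed
    with middle(1,3) have q: "q = inv_letter x # b" and "c = e @ [x]" by auto
    then have "inv_letter (inv_letter x) # e \<in> C_set R k"
      using C_set_rotate[of e "[x]"] corolla.hyps(2) by simp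
    from cactus_attach[OF assms(1) this corolla.hyps(1), of p b] q middle(2) show ?thesis by simp
  qed
qed simp

section \<open>Reducing the boundary word\<close>

text \<open>Each cancellation shortens the boundary or improves the cactus; the lexicographic
  measure puts the number of faces first, then the gap below the bound on the weight, then the
  length.\<close>

lemma cactus_reduced_form:
  assumes "group_presentation X R" "cactus R n m w"
  shows "\<exists>n m. cactus R n m (reduced_form w)"
  using assms(2)
proof (induction "(n, m, w)" arbitrary: n m w
    rule: wf_induct_rule[OF wf_measures[of "[\<lambda>(n, m, w). n, \<lambda>(n, m, w). 3 ^ Suc n - m, \<lambda>(n, m, w). length w]"]])
  case (1 n m w)
  show ?case
  proof (cases "reduced w")
    case True
    then show ?thesis using 1(2) by (auto simp: reduced_form_id)
  next
    case False
    then obtain a x b where w: "w = a @ [x, inv_letter x] @ b" by (rule not_reducedE)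
    then have rw: "reduced_form w = reduced_form (a @ b)" by (simp add: reduced_form_delete)
    from cactus_cancel[OF assms(1) 1(2), of a x b] w
    have "cactus R n m (a @ b) \<or> improvable R n m (a @ b)"
      by (simp add: cactus_or_better_def)
    then show ?thesis
    proof
      assume "cactus R n m (a @ b)"
      then show ?thesis using 1(1)[of n m "a @ b"] w rw by simp
    next
      assume "improvable R n m (a @ b)"
      then obtain n' m' z where z: "cactus R n' m' z" "reduced_form z = reduced_form (a @ b)"
        "n' < n \<or> n' = n \<and> m < m'" by (auto simp: improvable_def)
      \<comment> \<open>The weight bound keeps the truncated subtraction strictly
        decreasing.\<close>
      have "n' = n \<Longrightarrow> m < m' \<Longrightarrow> 3 ^ Suc n - m' < 3 ^ Suc n - m"
        using cactus_bound[OF z(1)] by (intro diff_less_mono2) auto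
      then show ?thesis using 1(1)[of n' m' z] z rw by auto
    qed
  qed
qed

section \<open>From cacti to the sets \<open>D_k\<close>\<close>

lemma D_rel_pos: "(k, w) \<in> D_rel X R \<Longrightarrow> k \<ge> 1"
  by (induction rule: D_rel.induct) auto

text \<open>A spur inserted last would leave a cancelling pair, so the last piece is a corolla,
  whose boundary is an unbroken subword. It is removed together with the path \<open>u\<close> that
  cancels once it is gone.\<close>

lemma cactus_D_set:
  assumes "group_presentation X R" "cactus R n m w" "reduced w" "w \<noteq> []" "w \<in> words_over X"
  shows "\<exists>k. w \<in> D_set X R k"
  using assms(2-)
proof (induction "length w" arbitrary: w n m rule: less_induct)
  case less
  from less.prems(1) show ?case
  proof cases
    case (edge a b x)
    with less.prems reduced_no_cancelling_pair[of a x b] show ?thesis by simp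
  next
    case (corolla n m p q c k)
    then obtain p' u q' where u: "p = p' @ u" "q = inv_word u @ q'" "reduced (p' @ q')"
      using less.prems(2) cancel_junction[of p q] by (auto simp: reduced_append)
    have "reduced_form (p @ q) = p' @ q'"
      using reduced_form_cong[of "u @ inv_word u" "[]" p' q'] u(3)
      by (simp add: u reduced_form_id)
    \<comment> \<open>The reduced remainder again bounds a cactus, but of unknown size; this is why
      the induction is on length.\<close>
    then obtain n' m' where pq: "cactus R n' m' (p' @ q')"
      using cactus_reduced_form[OF assms(1) corolla(4)] by auto
    have w: "w = p' @ (u @ c @ inv_word u) @ q'" using corolla(3) u(1,2) by simp
    have "reduced (u @ c @ inv_word u)"
      using less.prems(2) reduced_append[of p' "(u @ c @ inv_word u) @ q'"]
        reduced_append[of "u @ c @ inv_word u" q'] unfolding w by blast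
    moreover have "u \<in> words_over X" using less.prems(4) unfolding w by simp
    ultimately have conj: "(k, u @ c @ inv_word u) \<in> D_rel X R"
      using D_rel.conj[OF C_set_pos[OF corolla(5)] corolla(5)] by blast
    show ?thesis
    proof (cases "p' @ q' = []")
      case True
      then have "w = u @ c @ inv_word u" using w by simp
      with conj show ?thesis unfolding D_set_def by blast
    next
      case False
      have "c \<noteq> []" using C_set_word[OF assms(1) corolla(5)] by blast
      then have "length (p' @ q') < length w" unfolding w by simp
      moreover have "p' @ q' \<in> words_over X" using less.prems(4) unfolding w by simp
      ultimately obtain j where j: "(j, p' @ q') \<in> D_rel X R"
        using less.hyps[of "p' @ q'" n' m'] pq False u(3) unfolding D_set_def by blast
      have "(k + j, w) \<in> D_rel X R"
        using D_rel.insertion[OF C_set_pos[OF corolla(5)] D_rel_pos[OF j] conj j] less.prems(2)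
        unfolding w by blast
      then show ?thesis unfolding D_set_def by blast
    qed
  qed (use less.prems in simp)
qed

section \<open>Areas\<close>

lemma D_rel_word:
  assumes "group_presentation X R" "(k, w) \<in> D_rel X R"
  shows "reduced w \<and> w \<in> words_over X \<and> conj_prod X R k w"
  using assms(2)
proof induction
  case (conj k w u)
  then show ?case using C_set_word[OF assms(1) conj(2)] conj_prod_conj by auto
next
  case (insertion i j u w1 w2)
  have "conj_prod X R (i + j) ((w1 @ u @ inv_word w1) @ (w1 @ w2))"
    using insertion by (intro conj_prod_mult conj_prod_conj) auto
  then have "conj_prod X R (i + j) (w1 @ u @ w2)"
    by (rule conj_prod_cong) (simp add: free_simps)
  with insertion show ?case by auto
qed

text \<open>Write \<open>w1 u w2\<close> as \<open>(w1 u w1^-1) (w1 w2)\<close>. The assumptions on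
  \<open>conj_prod\<close> ensure that both areas are attained.\<close>

lemma area_insertion_le:
  assumes "reduced u" "reduced (w1 @ w2)" "reduced (w1 @ u @ w2)" "w1 \<in> words_over X"
    "conj_prod X R i u" "conj_prod X R j (w1 @ w2)"
  shows "area X R (w1 @ u @ w2) \<le> area X R u + area X R (w1 @ w2)"
proof (rule area_le[OF assms(3)])
  have "conj_prod X R (area X R u + area X R (w1 @ w2)) ((w1 @ u @ inv_word w1) @ (w1 @ w2))"
    using assms conj_prod_area by (intro conj_prod_mult conj_prod_conj) blast+
  then show "conj_prod X R (area X R u + area X R (w1 @ w2)) (w1 @ u @ w2)"
    by (rule conj_prod_cong) (simp add: free_simps)
qed

lemma area_conj_le:
  assumes "reduced w" "reduced (u @ w @ inv_word u)" "u \<in> words_over X" "conj_prod X R k w"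
  shows "area X R (u @ w @ inv_word u) \<le> area X R w"
  using assms conj_prod_area[of w X R k] by (intro area_le conj_prod_conj) auto

lemma D_rel_area_linear:
  fixes \<alpha> :: real
  assumes pres: "group_presentation X R" and "\<alpha> > 0"
    and corollas: "\<And>c. proper_corolla X R c \<Longrightarrow> real (area X R c) \<le> \<alpha> * real (length c)"
    and "(k, w) \<in> D_rel X R"
  shows "real (area X R w) \<le> \<alpha> * real (length w)"
  using assms(4)
proof (induction k arbitrary: w rule: less_induct)
  case (less k)
  from less.prems show ?case
  proof cases
    case (conj c u)
    note c = C_set_word[OF pres conj(3)]
    have "real (area X R c) \<le> \<alpha> * real (length c)"
    proof (cases "proper_corolla X R c")
      case False
      \<comment> \<open>As \<open>c\<close> lies in \<open>C_k\<close>, it can fail to be proper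
        only by lying in some \<open>D_h\<close> with \<open>h < k\<close>.\<close>
      then obtain h where "h < k" "(h, c) \<in> D_rel X R"
        using conj(3) by (auto simp: proper_corolla_def D_set_def)
      then show ?thesis by (rule less.IH)
    qed (rule corollas)
    moreover have "area X R w \<le> area X R c"
      using c conj unfolding conj(1) by (intro area_conj_le) (auto simp: cyclically_reduced_def)
    \<comment> \<open>Conjugation does not increase the area and does not decrease the
      length.\<close>
    moreover have "\<alpha> * real (length c) \<le> \<alpha> * real (length w)"
      using \<open>\<alpha> > 0\<close> conj by (intro mult_left_mono) auto
    ultimately show ?thesis by linarith
  next
    case (insertion i j u w1 w2)
    have "area X R w \<le> area X R u + area X R (w1 @ w2)"
      using D_rel_word[OF pres] insertion unfolding insertion(2)
      by (intro area_insertion_le) (fastforce)+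
    moreover have "real (area X R u) \<le> \<alpha> * real (length u)"
      "real (area X R (w1 @ w2)) \<le> \<alpha> * real (length (w1 @ w2))"
      using insertion by (intro less.IH; simp)+
    moreover have "\<alpha> * real (length w) = \<alpha> * real (length u) + \<alpha> * real (length (w1 @ w2))"
      by (simp add: insertion(2) algebra_simps)
    ultimately show ?thesis by linarith
  qed
qed

section \<open>Finiteness and the Dehn function\<close>

lemma finite_words_over: "finite X \<Longrightarrow> finite {w \<in> words_over X. length w \<le> n}"
  using finite_lists_length_le[of "X \<times> (UNIV :: bool set)" n]
  by (simp add: words_over_def lists_eq_set conj_commute)

text \<open>Makes the \<open>Max\<close> in \<open>dehn\<close> a genuine maximum; the empty relator
  shows that it is taken over a non-empty set.\<close>

lemma finite_areas:
  assumes "group_presentation X R" "finite X"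
  shows "finite {area X R w | w. relator X R w \<and> length w \<le> n}"
proof (rule finite_subset)
  show "finite (area X R ` {w \<in> words_over X. length w \<le> n})"
    using finite_words_over[OF assms(2)] by simp
qed (use relator_iff[OF assms(1)] in auto)

lemma relator_Nil: "group_presentation X R \<Longrightarrow> relator X R []"
  using conj_prod_0[of "[]" X R] by (auto simp: relator_iff)

theorem corollary4p1p4:
  fixes X :: "'a set" and R :: "'a word set"
  assumes "group_presentation X R" and "finite X" and "finite R"
  shows "hyperbolic_presentation X R \<longleftrightarrow>
    (\<exists>\<alpha>::real. \<alpha> > 0 \<and>
       (\<forall>c. proper_corolla X R c \<longrightarrow> real (area X R c) \<le> \<alpha> * real (length c)))"
proof
  assume "hyperbolic_presentation X R"
  then obtain \<alpha> :: real where \<alpha>: "\<alpha> > 0" "\<And>n. real (dehn X R n) \<le> \<alpha> * real n"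
    by (auto simp: hyperbolic_presentation_def)
  have "real (area X R c) \<le> \<alpha> * real (length c)" if "proper_corolla X R c" for c
  proof -
    obtain k where "c \<in> C_set R k" using \<open>proper_corolla X R c\<close> by (auto simp: proper_corolla_def)
    then have "relator X R c"
      using C_set_word[OF assms(1)] relator_iff[OF assms(1)] by (auto simp: cyclically_reduced_def)
    then have "area X R c \<le> dehn X R (length c)"
      unfolding dehn_def by (intro Max_ge finite_areas assms) auto
    then show ?thesis using \<alpha>(2)[of "length c"] by linarith
  qed
  with \<alpha>(1) show "\<exists>\<alpha>::real. \<alpha> > 0 \<and>
       (\<forall>c. proper_corolla X R c \<longrightarrow> real (area X R c) \<le> \<alpha> * real (length c))" by blast
next
  assume "\<exists>\<alpha>::real. \<alpha> > 0 \<and>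
       (\<forall>c. proper_corolla X R c \<longrightarrow> real (area X R c) \<le> \<alpha> * real (length c))"
  then obtain \<alpha> :: real where \<alpha>: "\<alpha> > 0"
    "\<And>c. proper_corolla X R c \<Longrightarrow> real (area X R c) \<le> \<alpha> * real (length c)" by blast
  have linear: "real (area X R w) \<le> \<alpha> * real (length w)" if "relator X R w" for w
  proof (cases "w = []")
    case True
    \<comment> \<open>The empty product shows that the empty word has area 0, as the bound demands
      at length 0.\<close>
    then show ?thesis using area_le[of "[]" X R 0] conj_prod_0[of "[]" X R] by simp
  next
    case False
    obtain k where w: "w \<in> words_over X" "reduced w" "conj_prod X R k w"
      using \<open>relator X R w\<close> relator_iff[OF assms(1)] by auto
    obtain z where "cactus R k (3 * k) z" "reduced_form z = w"
      using conj_prod_cactus[OF w(3)] w(2) by (auto simp: reduced_form_id)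
    then obtain n m where "cactus R n m w"
      using cactus_reduced_form[OF assms(1)] by blast
    then obtain j where "(j, w) \<in> D_rel X R"
      using cactus_D_set[OF assms(1) _ w(2) False w(1)] unfolding D_set_def by blast
    then show ?thesis using D_rel_area_linear[OF assms(1) \<alpha>] by blast
  qed
  have "real (dehn X R n) \<le> \<alpha> * real n" for n
  proof -
    have "dehn X R n \<in> {area X R w | w. relator X R w \<and> length w \<le> n}"
      unfolding dehn_def using relator_Nil[OF assms(1)] by (intro Max_in finite_areas assms) fastforce
    then obtain w where w: "dehn X R n = area X R w" "relator X R w" "length w \<le> n" by auto
    have "\<alpha> * real (length w) \<le> \<alpha> * real n" using \<alpha>(1) w(3) by (intro mult_left_mono) auto
    with linear[OF w(2)] w(1) show ?thesis by linarith
  qed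
  with \<alpha>(1) show "hyperbolic_presentation X R" by (auto simp: hyperbolic_presentation_def)
qed

end
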